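(* Let $\gamma_2>0$ and $0<9\delta<2l-n$. Then there is $k_0=k_0(V,\gamma_2,\delta)$ such that for every $k>k_0$ the following holds. If $t$ belongs to the $(k^{-n+1-7\delta})$-neighborhood in $K$ of the resonant set $\chi_q(k,\delta)$ and $A\in\mathbb C$ satisfies $|\sigma||A|^2<k^{-\gamma_2}$, then there is a pair of functions $u^{\pm}(x,t)$ and corresponding real values $\lambda^{\pm}(t)$ solving $$(-\Delta)^l u^\pm+Vu^\pm+\sigma|u^\pm|^2u^\pm=\lambda^\pm(t) u^\pm$$ with the quasi-periodic boundary conditions. Moreover, as $k\to\infty$, $$u^{\pm}(x,t)=A e^{i\langle P_j(t),x\rangle}\big(\psi_{-1}^{\pm}(x,t)+\phi^{\pm}(x,t)\big),\qquad \lambda^{\pm}(t)=\hat\lambda^{\pm}(t)+O(k^{-\gamma}),$$ where $\psi^\pm_{-1}(x,t)=\hat E^\pm(t)_{jj}+\hat E^\pm(t)_{j-q,j}\,e^{-i\langle q,x\rangle}$, the function $\phi^\pm(x,t)$ is $2\pi$-periodic in each $x_s$ and satisfies $\|\phi^\pm\|_*\le \hat c\,k^{-\gamma}$ with $\hat c=\hat c(V)$, and $\gamma=\min\{\gamma_1,\gamma_2\}$, $2\gamma_1=2l-n-8\delta$.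
   Context: Setting. $l,n$ are fixed positive integers with $2l>n$; $\sigma\in\mathbb R$; $Q=[0,2\pi]^n$; $K=[0,1)^n$. $V(x)=\sum_{m\in\mathbb Z^n,\,0<|m|\le R_0}v_me^{i\langle m,x\rangle}$ is a real-valued trigonometric polynomial, not identically zero, and $q\in\mathbb Z^n\setminus\{0\}$ is fixed with $v_q\neq0$. For a $2\pi$-periodic $W$ with Fourier coefficients $w_m$, $\|W\|_*=\sum_{m\in\mathbb Z^n}|w_m|$. For $j\in\mathbb Z^n$: $P_j(t)=j+t$, $p_j(t)=|P_j(t)|$. Quasi-periodic boundary conditions with quasimomentum $t$: for $s=1,\dots,n$ and $r=0,\dots,2l-1$, $\partial_{x_s}^ru(x_1,\dots,x_s+2\pi,\dots,x_n)=e^{2\pi i t_s}\partial_{x_s}^ru(x)$. Resonant set. $S(k)$ is the sphere of radius $k$ centered at $0$ in $\mathbb R^n$, $S_q(k,n-2+\delta)=\{x\in S(k):\big||x|^2-|x-q|^2\big|<4k^{-n+2-\delta}\}$, and $\mathcal K:\mathbb R^n\to K$ is $\mathcal KP_m(t)=t$. $\chi_q(k,\delta)$ is a subset of $\mathcal KS_q(k,n-2+\delta)$ such that for each $t\in\chi_q(k,\delta)$: there is $j\in\mathbb Z^n$ with $P_j(t)\in S_q(k,n-2+\delta)$ (so $|P_j(t)|=k$); $|p_{j-q}^2(t)-p_j^2(t)|<4k^{-n+2-\delta}$; and $\min_{i\ne j,j-q}|p_j^2(t)-p_i^2(t)|>2k^{-n+2-6\delta}$. It has asymptotically full measure in $\mathcal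 KS_q(k,n-2+\delta)$ (the relative measure of the complement is $O(k^{-\delta/2})$, $k\to\infty$). For $t$ in a small neighborhood of $\chi_q(k,\delta)$, $j$ denotes the index attached to a nearby point of $\chi_q(k,\delta)$. The set also has the following separation property: for $t$ in its $(2k^{-n+1-7\delta})$-neighborhood and all $z$ on either circle $C_1^\pm=\{z:|z-\hat\lambda^\pm(t)|=d\}$, $d=\frac1{10}|v_q|$, one has $2|p_m^{2l}(t)-z|\ge k^{2l-n-6\delta}$ for $m\neq j,j-q$. Model matrix. $\hat\lambda^\pm(t)=a\pm b$, with $2a=p_j^{2l}(t)+p_{j-q}^{2l}(t)$ and $2b=(4|v_q|^2+(p_j^{2l}(t)-p_{j-q}^{2l}(t))^2)^{1/2}$, are the eigenvalues of $\begin{pmatrix}p_j^{2l}(t)&v_q\\ v_{-q}&p_{j-q}^{2l}(t)\end{pmatrix}$. $\hat E^\pm(t)$ is the corresponding rank-one orthogonal spectral projection, viewed as a matrix indexed by $\mathbb Z^n\times\mathbb Z^n$ whose entries vanish unless both indices lie in $\{j,j-q\}$ (first coordinate $\leftrightarrow j$, second $\leftrightarrow j-q$). *)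

theory Defs
  imports "HOL-Analysis.Analysis"
begin

section \<open>Lattice, quasimomenta and the potential\<close>

definition rvec :: "int ^ 'n \<Rightarrow> real ^ 'n" where
  "rvec m = (\<chi> s. real_of_int (m $ s))"

definition Pvec :: "int ^ 'n \<Rightarrow> real ^ 'n \<Rightarrow> real ^ 'n" where
  "Pvec j t = rvec j + t"

definition pnorm :: "int ^ 'n \<Rightarrow> real ^ 'n::finite \<Rightarrow> real" where
  "pnorm j t = norm (Pvec j t)"

definition Kcell :: "(real ^ 'n) set" where
  "Kcell = {t. \<forall>s. 0 \<le> t $ s \<and> t $ s < 1}"

text \<open>Every point of the space is uniquely \<open>Pvec m t\<close> with \<open>t \<in> Kcell\<close>; this maps it to \<open>t\<close>.\<close>

definition Kmap :: "real ^ 'n \<Rightarrow> real ^ 'n" where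
  "Kmap x = (\<chi> s. frac (x $ s))"

definition trig_poly :: "(int ^ 'n \<Rightarrow> complex) \<Rightarrow> real \<Rightarrow> real ^ 'n::finite \<Rightarrow> complex" where
  "trig_poly v R x =
     (\<Sum>m | 0 < norm (rvec m) \<and> norm (rvec m) \<le> R. v m * cis (rvec m \<bullet> x))"


section \<open>Periodic functions and the Wiener norm\<close>

definition periodic :: "(real ^ 'n::finite \<Rightarrow> complex) \<Rightarrow> bool" where
  "periodic W \<longleftrightarrow> (\<forall>s x. W (x + (2 * pi) *\<^sub>R axis s 1) = W x)"

definition fourier_coeff :: "(real ^ 'n::finite \<Rightarrow> complex) \<Rightarrow> int ^ 'n \<Rightarrow> complex" where
  "fourier_coeff W m =
     integral (cbox 0 (\<chi> s. 2 * pi)) (\<lambda>x. W x * cis (- (rvec m \<bullet> x))) / (2 * pi) ^ CARD('n)"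

text \<open>Valued in \<open>ennreal\<close>, so that a divergent sum is \<open>\<infinity>\<close> rather than \<open>0\<close>.\<close>

definition star_norm :: "(real ^ 'n::finite \<Rightarrow> complex) \<Rightarrow> ennreal" where
  "star_norm W = (\<Sum>\<^sub>\<infinity>m\<in>UNIV. ennreal (cmod (fourier_coeff W m)))"


section \<open>The differential equation\<close>

definition partial :: "'n \<Rightarrow> (real ^ 'n \<Rightarrow> complex) \<Rightarrow> real ^ 'n::finite \<Rightarrow> complex" where
  "partial s u x = vector_derivative (\<lambda>h. u (x + h *\<^sub>R axis s 1)) (at 0)"

primrec C_class :: "nat \<Rightarrow> (real ^ 'n::finite \<Rightarrow> complex) \<Rightarrow> bool" where
  "C_class 0 u \<longleftrightarrow> continuous_on UNIV u"
| "C_class (Suc r) u \<longleftrightarrow> continuous_on UNIV u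
     \<and> (\<forall>s x. (\<lambda>h::real. u (x + h *\<^sub>R axis s 1)) differentiable (at 0))
     \<and> (\<forall>s. C_class r (partial s u))"

definition neg_laplacian :: "(real ^ 'n::finite \<Rightarrow> complex) \<Rightarrow> real ^ 'n \<Rightarrow> complex" where
  "neg_laplacian u x = - (\<Sum>s\<in>UNIV. partial s (partial s u) x)"

text \<open>Classical solutions, extended from the cell \<open>[0, 2\<pi>]\<^sup>n\<close> to the whole space.\<close>

definition solves_equation ::
  "nat \<Rightarrow> (real ^ 'n::finite \<Rightarrow> complex) \<Rightarrow> real \<Rightarrow> real \<Rightarrow> (real ^ 'n \<Rightarrow> complex) \<Rightarrow> bool" where
  "solves_equation l V \<sigma> \<mu> u \<longleftrightarrow> C_class (2 * l) u
     \<and> (\<forall>x. (neg_laplacian ^^ l) u x + V x * u x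
            + of_real (\<sigma> * (cmod (u x))\<^sup>2) * u x = of_real \<mu> * u x)"

definition quasi_periodic ::
  "nat \<Rightarrow> real ^ 'n::finite \<Rightarrow> (real ^ 'n \<Rightarrow> complex) \<Rightarrow> bool" where
  "quasi_periodic l t u \<longleftrightarrow> (\<forall>s. \<forall>r<2 * l. \<forall>x.
     (partial s ^^ r) u (x + (2 * pi) *\<^sub>R axis s 1)
       = cis (2 * pi * t $ s) * (partial s ^^ r) u x)"


section \<open>The model matrix\<close>

text \<open>The sign in \<open>\<plusminus>\<close> is a parameter \<open>\<epsilon> \<in> {1, -1}\<close>.\<close>

definition lam_hat ::
  "nat \<Rightarrow> (int ^ 'n \<Rightarrow> complex) \<Rightarrow> int ^ 'n \<Rightarrow> int ^ 'n \<Rightarrow> real \<Rightarrow> real ^ 'n::finite \<Rightarrow> real" where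
  "lam_hat l v q j \<epsilon> t =
     (let a = (pnorm j t ^ (2 * l) + pnorm (j - q) t ^ (2 * l)) / 2;
          b = sqrt (4 * (cmod (v q))\<^sup>2 + (pnorm j t ^ (2 * l) - pnorm (j - q) t ^ (2 * l))\<^sup>2) / 2
      in a + \<epsilon> * b)"

definition model_matrix ::
  "nat \<Rightarrow> (int ^ 'n \<Rightarrow> complex) \<Rightarrow> int ^ 'n \<Rightarrow> int ^ 'n \<Rightarrow> real ^ 'n::finite \<Rightarrow> complex ^ 2 ^ 2" where
  "model_matrix l v q j t = vector
     [vector [of_real (pnorm j t ^ (2 * l)), v q],
      vector [v (- q), of_real (pnorm (j - q) t ^ (2 * l))]]"

definition orth_eigenprojection :: "complex ^ 2 ^ 2 \<Rightarrow> complex \<Rightarrow> complex ^ 2 ^ 2 \<Rightarrow> bool" where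
  "orth_eigenprojection M \<mu> E \<longleftrightarrow>
     E ** E = E \<and> (\<forall>i k. E $ i $ k = cnj (E $ k $ i))
     \<and> range ((*v) E) = {w. M *v w = \<mu> *s w}"

lemma orth_eigenprojection_unique:
  assumes "orth_eigenprojection M \<mu> E" "orth_eigenprojection M \<mu> F"
  shows "E = F"
proof -
  have absorb: "A ** B = B"
    if "A ** A = A" and sub: "range ((*v) B) \<subseteq> range ((*v) A)" for A B :: "complex ^ 2 ^ 2"
  proof -
    have "(A ** B) *v x = B *v x" for x
    proof -
      obtain y where "B *v x = A *v y" using sub by blast
      then show ?thesis using \<open>A ** A = A\<close> by (metis matrix_vector_mul_assoc)
    qed
    then show ?thesis by (simp add: matrix_eq)
  qed
  have herm: "A ** B = B \<longleftrightarrow> B ** A = B"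
    if A: "\<forall>i k. A $ i $ k = cnj (A $ k $ i)" and B: "\<forall>i k. B $ i $ k = cnj (B $ k $ i)"
    for A B :: "complex ^ 2 ^ 2"
  proof -
    have "(A ** B) $ i $ k = cnj ((B ** A) $ k $ i)" for i k
    proof -
      have "A $ i $ m * B $ m $ k = cnj (B $ k $ m * A $ m $ i)" for m
        unfolding complex_cnj_mult A[rule_format, of i m, symmetric]
          B[rule_format, of m k, symmetric] by (rule mult.commute)
      then show ?thesis by (simp only: matrix_matrix_mult_def vec_lambda_beta cnj_sum)
    qed
    then have "A ** B = B \<longleftrightarrow> (\<forall>i k. cnj ((B ** A) $ k $ i) = B $ i $ k)"
      by (simp only: vec_eq_iff)
    also have "\<dots> \<longleftrightarrow> (\<forall>i k. cnj ((B ** A) $ k $ i) = cnj (B $ k $ i))"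
      by (metis B)
    also have "\<dots> \<longleftrightarrow> B ** A = B"
      by (auto simp: vec_eq_iff)
    finally show ?thesis .
  qed
  have "E ** F = F" "F ** E = E"
    using absorb[of E F] absorb[of F E] assms by (simp_all only: orth_eigenprojection_def)
  moreover have "F ** E = F"
    using herm[of E F] calculation(1) assms unfolding orth_eigenprojection_def by blast
  ultimately show ?thesis by simp
qed

lemma orth_eigenprojection_exists:
  fixes a c \<epsilon> :: real and w :: complex
  assumes "\<epsilon> \<in> {1, -1}" "w \<noteq> 0"
  defines "\<mu> \<equiv> (a + c) / 2 + \<epsilon> * (sqrt (4 * (cmod w)\<^sup>2 + (a - c)\<^sup>2) / 2)"
  shows "\<exists>E. orth_eigenprojection
    (vector [vector [of_real a, w], vector [cnj w, of_real c]]) (of_real \<mu>) E"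
proof -
  define d where "d = \<mu> - a"
  define N where "N = (cmod w)\<^sup>2 + d\<^sup>2"
  define D where "D = complex_of_real d"
  define M :: "complex ^ 2 ^ 2"
    where "M = vector [vector [of_real a, w], vector [cnj w, of_real c]]"
  define E :: "complex ^ 2 ^ 2" where "E = vector
    [vector [w * cnj w / of_real N, w * D / of_real N],
     vector [cnj w * D / of_real N, D * D / of_real N]]"
  have N: "N > 0" using assms(2) by (simp add: N_def add_pos_nonneg)
  have Nc: "complex_of_real N = w * cnj w + D * D"
    by (simp add: N_def D_def power2_eq_square[of d] complex_norm_square[symmetric])
  have N0: "w * cnj w + D * D \<noteq> 0" using N Nc by (metis of_real_eq_0_iff less_irrefl)
  define r where "r = sqrt (4 * (cmod w)\<^sup>2 + (a - c)\<^sup>2)"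
  have r2: "r * r = 4 * (cmod w)\<^sup>2 + (a - c)\<^sup>2"
    by (simp add: r_def)
  have e2: "\<epsilon> * \<epsilon> = 1" using assms(1) by auto
  have "d * (\<mu> - c) = (\<epsilon> * \<epsilon> * (r * r) - (a - c)\<^sup>2) / 4"
    by (simp add: d_def \<mu>_def flip: r_def) (simp add: field_simps power2_eq_square)
  then have quad: "d * (\<mu> - c) = (cmod w)\<^sup>2" by (simp add: e2 r2)
  have quadc: "D * (of_real \<mu> - of_real c) = w * cnj w"
    by (metis D_def quad complex_norm_square of_real_diff of_real_mult)
  have Da: "of_real \<mu> = D + of_real a" by (simp add: D_def d_def)
  have idem: "E ** E = E"
    using N0 unfolding E_def Nc
    by (simp add: vec_eq_iff forall_2 matrix_matrix_mult_def sum_2 divide_simps)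
       (simp add: algebra_simps)
  have herm: "\<forall>i k. E $ i $ k = cnj (E $ k $ i)"
    by (simp add: E_def forall_2 D_def mult.commute)
  have eig: "M *v (E *v x) = of_real \<mu> *s (E *v x)" for x
  proof -
    have q: "cnj w * w + of_real c * D = of_real \<mu> * D"
      using quadc by (simp add: algebra_simps)
    have x: "of_real a * (w * cnj w) + w * (cnj w * D) = (D + of_real a) * (w * cnj w)"
      "of_real a * (w * D) + w * (D * D) = (D + of_real a) * (w * D)"
      "cnj w * (w * cnj w) + of_real c * (cnj w * D) = (D + of_real a) * (cnj w * D)"
      "cnj w * (w * D) + of_real c * (D * D) = (D + of_real a) * (D * D)"
      using q[unfolded Da] by algebra+
    have "M ** E = (\<chi> i k. of_real \<mu> * E $ i $ k)"
      using x unfolding vec_eq_iff forall_2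
      by (simp add: E_def M_def matrix_matrix_mult_def sum_2 Da add_divide_distrib[symmetric])
    then have "(M ** E) *v x = of_real \<mu> *s (E *v x)"
      by (simp add: vec_eq_iff matrix_vector_mult_def sum_distrib_left mult.assoc)
    then show ?thesis by (simp add: matrix_vector_mul_assoc)
  qed
  have fixed: "E *v x = x" if "M *v x = of_real \<mu> *s x" for x
  proof -
    have 1: "w * x $ 2 = D * x $ 1"
      using that Da by (simp add: vec_eq_iff forall_2 M_def matrix_vector_mult_def sum_2 algebra_simps)
    have "w * cnj w * x $ 1 + w * D * x $ 2 = (w * cnj w + D * D) * x $ 1"
      "cnj w * D * x $ 1 + D * D * x $ 2 = (w * cnj w + D * D) * x $ 2"
      using 1 by algebra+
    then show ?thesis
      using N0 unfolding vec_eq_iff forall_2 E_def Nc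
      by (simp add: matrix_vector_mult_def sum_2 divide_simps)
  qed
  have "range ((*v) E) = {x. M *v x = of_real \<mu> *s x}"
    using eig fixed by (auto simp: image_iff) metis
  then show ?thesis
    using idem herm unfolding orth_eigenprojection_def M_def by blast
qed

definition E_hat ::
  "nat \<Rightarrow> (int ^ 'n \<Rightarrow> complex) \<Rightarrow> int ^ 'n \<Rightarrow> int ^ 'n \<Rightarrow> real \<Rightarrow> real ^ 'n::finite
     \<Rightarrow> int ^ 'n \<Rightarrow> int ^ 'n \<Rightarrow> complex" where
  "E_hat l v q j \<epsilon> t m m' =
     (let E = (THE E. orth_eigenprojection (model_matrix l v q j t)
                        (of_real (lam_hat l v q j \<epsilon> t)) E);
          pos = (\<lambda>i. if i = j then 1 else 2)
      in if m \<in> {j, j - q} \<and> m' \<in> {j, j - q} then E $ pos m $ pos m' else 0)"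

definition psi ::
  "nat \<Rightarrow> (int ^ 'n \<Rightarrow> complex) \<Rightarrow> int ^ 'n \<Rightarrow> int ^ 'n \<Rightarrow> real \<Rightarrow> real ^ 'n::finite
     \<Rightarrow> real ^ 'n \<Rightarrow> complex" where
  "psi l v q j \<epsilon> t x =
     E_hat l v q j \<epsilon> t j j + E_hat l v q j \<epsilon> t (j - q) j * cis (- (rvec q \<bullet> x))"


section \<open>The resonant set\<close>

definition S_q :: "int ^ 'n::finite \<Rightarrow> real \<Rightarrow> real \<Rightarrow> (real ^ 'n) set" where
  "S_q q \<delta> k = {x \<in> sphere 0 k.
     \<bar>(norm x)\<^sup>2 - (norm (x - rvec q))\<^sup>2\<bar> < 4 * k powr (- real CARD('n) + 2 - \<delta>)}"

text \<open>\<open>j\<close> is an index attached to the point \<open>t\<close> of the resonant set.\<close>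

definition attached_index ::
  "int ^ 'n::finite \<Rightarrow> real \<Rightarrow> real \<Rightarrow> real ^ 'n \<Rightarrow> int ^ 'n \<Rightarrow> bool" where
  "attached_index q \<delta> k t j \<longleftrightarrow>
     Pvec j t \<in> S_q q \<delta> k
     \<and> \<bar>(pnorm (j - q) t)\<^sup>2 - (pnorm j t)\<^sup>2\<bar> < 4 * k powr (- real CARD('n) + 2 - \<delta>)
     \<and> (\<forall>i. i \<noteq> j \<longrightarrow> i \<noteq> j - q \<longrightarrow>
          \<bar>(pnorm j t)\<^sup>2 - (pnorm i t)\<^sup>2\<bar> > 2 * k powr (- real CARD('n) + 2 - 6 * \<delta>))"

text \<open>\<open>t\<close> lies in the \<open>r\<close>-neighbourhood in \<open>Kcell\<close> of \<open>X\<close>, and \<open>j\<close> is an index attached to a point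
  of \<open>X\<close> at distance less than \<open>r\<close> from \<open>t\<close>.\<close>

definition near_resonant ::
  "int ^ 'n::finite \<Rightarrow> real \<Rightarrow> real \<Rightarrow> (real ^ 'n) set \<Rightarrow> real \<Rightarrow> real ^ 'n \<Rightarrow> int ^ 'n \<Rightarrow> bool" where
  "near_resonant q \<delta> k X r t j \<longleftrightarrow>
     t \<in> Kcell \<and> (\<exists>t\<^sub>0\<in>X. dist t t\<^sub>0 < r \<and> attached_index q \<delta> k t\<^sub>0 j)"

definition separated ::
  "nat \<Rightarrow> (int ^ 'n::finite \<Rightarrow> complex) \<Rightarrow> int ^ 'n \<Rightarrow> real \<Rightarrow> real \<Rightarrow> real ^ 'n \<Rightarrow> int ^ 'n \<Rightarrow> bool" where
  "separated l v q \<delta> k t j \<longleftrightarrow>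
     (\<forall>\<epsilon>\<in>{1, -1}. \<forall>z\<in>sphere (complex_of_real (lam_hat l v q j \<epsilon> t)) (cmod (v q) / 10).
        \<forall>m. m \<noteq> j \<longrightarrow> m \<noteq> j - q \<longrightarrow>
          2 * cmod (of_real (pnorm m t ^ (2 * l)) - z)
            \<ge> k powr (2 * real l - real CARD('n) - 6 * \<delta>))"

definition resonant_set ::
  "nat \<Rightarrow> (int ^ 'n::finite \<Rightarrow> complex) \<Rightarrow> int ^ 'n \<Rightarrow> real \<Rightarrow> real \<Rightarrow> (real ^ 'n) set \<Rightarrow> bool" where
  "resonant_set l v q \<delta> k X \<longleftrightarrow>
     X \<subseteq> Kmap ` S_q q \<delta> k
     \<and> (\<forall>t\<in>X. \<exists>j. attached_index q \<delta> k t j)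
     \<and> (\<forall>t j. near_resonant q \<delta> k X (2 * k powr (- real CARD('n) + 1 - 7 * \<delta>)) t j
          \<longrightarrow> separated l v q \<delta> k t j)"

text \<open>The \<open>d\<close>-dimensional Hausdorff (outer) measure, up to normalisation. The boundedness
  requirement is needed because \<open>diameter\<close> is a junk value on unbounded sets, and empty pieces
  are discounted so that \<open>d = 0\<close> gives the counting measure.\<close>

definition hausdorff_measure :: "nat \<Rightarrow> 'a::metric_space set \<Rightarrow> ennreal" where
  "hausdorff_measure d A =
     (SUP \<eta>\<in>{0<..}. INF C\<in>{C :: nat \<Rightarrow> 'a set.
          A \<subseteq> (\<Union>i. C i) \<and> (\<forall>i. bounded (C i) \<and> diameter (C i) \<le> \<eta>)}.
        (\<Sum>i. if C i = {} then 0 else ennreal (diameter (C i) ^ d)))"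

definition asymptotically_full ::
  "int ^ 'n::finite \<Rightarrow> real \<Rightarrow> (real \<Rightarrow> (real ^ 'n) set) \<Rightarrow> bool" where
  "asymptotically_full q \<delta> X \<longleftrightarrow> (\<exists>C. \<forall>\<^sub>F k in at_top.
     hausdorff_measure (CARD('n) - 1) (Kmap ` S_q q \<delta> k - X k)
       \<le> ennreal (C * k powr (- \<delta> / 2))
          * hausdorff_measure (CARD('n) - 1) (Kmap ` S_q q \<delta> k))"

end

theory Submission
  imports Defs
begin

text \<open>
  Write \<open>u = A s exp (i \<langle>P\<^sub>j(t), x\<rangle>) W(x)\<close> with \<open>W\<close> in the Wiener algebra; the coefficients of \<open>W\<close> then solve an
  equation in \<open>\<ell>\<^sup>1(\<int>\<^sup>n)\<close> whose linear part is the diagonal matrix of the \<open>p\<^sub>j\<^sub>+\<^sub>m(t)\<^sup>2\<^sup>l\<close> plus convolution with the potential.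
  On the two resonant indices \<open>0\<close> and \<open>-q\<close> this is the model matrix, with eigenvalues at distance at
  least \<open>2|v\<^sub>q|\<close>; at all other indices the separation property makes the diagonal entry differ from the model
  eigenvalue by at least \<open>k\<^sup>p/4\<close>, where \<open>p = 2l - n - 6\<delta>\<close>. A Lyapunov--Schmidt reduction around the model
  eigenvector is therefore a contraction with constant \<open>O(k\<^sup>-\<^sup>p + |\<sigma>||A|\<^sup>2)\<close>, and this is also the size of the
  correction. The scalar \<open>s\<close> turns the unit eigenvector into column \<open>j\<close> of the projection, and \<open>|s| \<le> 1\<close>
  only weakens the nonlinearity. The eigenvalue is real because the potential \<open>V + \<sigma>|u|\<^sup>2\<close> is.
\<close>

section \<open>The Banach space of absolutely summable families\<close>

text \<open>The obstacle is that the gap between the two model eigenvalues is only guaranteed to be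
  of the order of \<open>v q\<close>, so on the resonant block the potential is no small
  perturbation. Once the block is diagonalised, and since the potential has mean zero, the rest of
  the lattice acts on the block only through a round trip: potential, off-block resolvent,
  potential. The resolvent makes this small; the only other contribution is the cubic term. The
  correction is normalised to have no component along the model eigenvector, which removes the
  freedom of scaling and phase. Projecting the equation on that eigenvector then yields the shift of
  the eigenvalue. This is one complex equation for one real unknown: only its real half is imposed,
  and its imaginary half is recovered afterwards from the symmetry of the equation. All Lipschitz
  constants are explicit in the norm of the potential, the resolvent bound, the gap and the
  coupling. Hence the constant in front of the power of k can be fixed before
  \<open>\<gamma>\<^sub>2\<close> and \<delta>.\<close>

no_notation Infinite_Set_Sum.abs_summable_on (infix "abs'_summable'_on" 50)

text \<open>A type rather than a set of functions, so that it can be made an instance of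
  \<open>banach\<close> and \<open>reduced_fixed_point\<close> applies to it.\<close>

typedef 'a ell1 = "{x :: 'a \<Rightarrow> complex. x abs_summable_on UNIV}"
  morphisms cf Abs_ell1
  by (rule exI[of _ "\<lambda>_. 0"]) simp

setup_lifting type_definition_ell1

lemma cf_abs_summable: "cf x abs_summable_on UNIV"
  using cf[of x] by simp

lemma cf_Abs: "f abs_summable_on UNIV \<Longrightarrow> cf (Abs_ell1 f) = f"
  by (simp add: Abs_ell1_inverse)

lemma ell1_eqI: "(\<And>m. cf x m = cf y m) \<Longrightarrow> x = y"
  by (metis cf_inject ext)

instantiation ell1 :: (type) real_vector
begin

lift_definition zero_ell1 :: "'a ell1" is "\<lambda>_. 0" by simp

lift_definition plus_ell1 :: "'a ell1 \<Rightarrow> 'a ell1 \<Rightarrow> 'a ell1" is "\<lambda>x y m. x m + y m"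
proof -
  fix x y :: "'a \<Rightarrow> complex"
  assume "x abs_summable_on UNIV" "y abs_summable_on UNIV"
  then have "(\<lambda>m. cmod (x m) + cmod (y m)) summable_on UNIV"
    by (rule summable_on_add)
  then show "(\<lambda>m. x m + y m) abs_summable_on UNIV"
    by (rule Infinite_Sum.abs_summable_on_comparison_test') (rule norm_triangle_ineq)
qed

lift_definition uminus_ell1 :: "'a ell1 \<Rightarrow> 'a ell1" is "\<lambda>x m. - x m" by simp

definition minus_ell1 :: "'a ell1 \<Rightarrow> 'a ell1 \<Rightarrow> 'a ell1" where "minus_ell1 x y = x + - y"

lift_definition scaleR_ell1 :: "real \<Rightarrow> 'a ell1 \<Rightarrow> 'a ell1" is "\<lambda>r x m. r *\<^sub>R x m"
proof -
  fix r :: real and x :: "'a \<Rightarrow> complex"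
  assume "x abs_summable_on UNIV"
  then show "(\<lambda>m. r *\<^sub>R x m) abs_summable_on UNIV"
    using summable_on_cmult_right[of "\<lambda>m. cmod (x m)" UNIV "\<bar>r\<bar>"] by simp
qed

instance
proof
  fix x y z :: "'a ell1" and a b :: real
  note rep = zero_ell1.rep_eq plus_ell1.rep_eq uminus_ell1.rep_eq scaleR_ell1.rep_eq
  show "x + y + z = x + (y + z)" "x + y = y + x" "0 + x = x" "- x + x = 0"
    by (rule ell1_eqI; simp add: rep)+
  show "x - y = x + - y" by (rule minus_ell1_def)
  show "a *\<^sub>R (x + y) = a *\<^sub>R x + a *\<^sub>R y" "(a + b) *\<^sub>R x = a *\<^sub>R x + b *\<^sub>R x"
    "a *\<^sub>R b *\<^sub>R x = (a * b) *\<^sub>R x" "1 *\<^sub>R x = x"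
    by (rule ell1_eqI; simp add: rep scaleR_add_right scaleR_add_left)+
qed

end

instantiation ell1 :: (type) real_normed_vector
begin

definition norm_ell1 :: "'a ell1 \<Rightarrow> real" where "norm_ell1 x = (\<Sum>\<^sub>\<infinity>m. cmod (cf x m))"
definition sgn_ell1 :: "'a ell1 \<Rightarrow> 'a ell1" where "sgn_ell1 x = x /\<^sub>R norm x"
definition dist_ell1 :: "'a ell1 \<Rightarrow> 'a ell1 \<Rightarrow> real" where "dist_ell1 x y = norm (x - y)"
definition uniformity_ell1 :: "('a ell1 \<times> 'a ell1) filter"
  where "uniformity_ell1 = (INF e\<in>{0<..}. principal {(x, y). dist x y < e})"
definition open_ell1 :: "'a ell1 set \<Rightarrow> bool"
  where "open_ell1 U = (\<forall>x\<in>U. eventually (\<lambda>(x', y). x' = x \<longrightarrow> y \<in> U) uniformity)"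

instance
proof
  fix x y :: "'a ell1" and a :: real
  show "dist x y = norm (x - y)" "sgn x = x /\<^sub>R norm x"
    by (simp_all add: dist_ell1_def sgn_ell1_def)
  show "uniformity = (INF e\<in>{0<..}. principal {(x :: 'a ell1, y). dist x y < e})"
    by (rule uniformity_ell1_def)
  show "open U \<longleftrightarrow> (\<forall>x\<in>U. eventually (\<lambda>(x', y). x' = x \<longrightarrow> y \<in> U) uniformity)"
    for U :: "'a ell1 set"
    by (rule open_ell1_def)
  have z: "cf (0 :: 'a ell1) m = 0" for m by (simp add: zero_ell1.rep_eq)
  show "norm x = 0 \<longleftrightarrow> x = 0"
  proof
    assume "norm x = 0"
    then have "cf x m = 0" for m
      using nonneg_infsum_le_0D[of "\<lambda>m. cmod (cf x m)" UNIV m] cf_abs_summable[of x]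
      by (simp add: norm_ell1_def)
    then show "x = 0" by (intro ell1_eqI) (simp add: z)
  qed (simp add: norm_ell1_def z)
  have "norm (x + y) \<le> (\<Sum>\<^sub>\<infinity>m. cmod (cf x m) + cmod (cf y m))"
    unfolding norm_ell1_def
  proof (rule infsum_mono)
    show "cf (x + y) abs_summable_on UNIV"
      "(\<lambda>m. cmod (cf x m) + cmod (cf y m)) summable_on UNIV"
      by (rule cf_abs_summable, rule summable_on_add[OF cf_abs_summable cf_abs_summable])
  qed (unfold plus_ell1.rep_eq, rule norm_triangle_ineq)
  then show "norm (x + y) \<le> norm x + norm y"
    unfolding norm_ell1_def infsum_add[OF cf_abs_summable cf_abs_summable] .
  show "norm (a *\<^sub>R x) = \<bar>a\<bar> * norm x"
    unfolding norm_ell1_def scaleR_ell1.rep_eq norm_scaleR by (rule infsum_cmult_right')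
qed

end

lemma cf_0 [simp]: "cf 0 m = 0"
  and cf_add [simp]: "cf (x + y) m = cf x m + cf y m"
  and cf_uminus [simp]: "cf (- x) m = - cf x m"
  and cf_scaleR [simp]: "cf (r *\<^sub>R x) m = of_real r * cf x m"
  by (simp_all add: zero_ell1.rep_eq plus_ell1.rep_eq uminus_ell1.rep_eq scaleR_ell1.rep_eq
      scaleR_conv_of_real)

lemma cf_diff [simp]: "cf (x - y) m = cf x m - cf y m"
  by (simp only: diff_conv_add_uminus cf_add cf_uminus)

lemma sum_cf_le_norm: "finite F \<Longrightarrow> (\<Sum>m\<in>F. cmod (cf x m)) \<le> norm x"
  unfolding norm_ell1_def by (rule finite_sum_le_infsum) (auto intro: cf_abs_summable)

lemma cf_le_norm: "cmod (cf x m) \<le> norm x"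
  using sum_cf_le_norm[of "{m}" x] by simp

lemma cf2_le_norm: "m \<noteq> m' \<Longrightarrow> cmod (cf x m) + cmod (cf x m') \<le> norm x"
  using sum_cf_le_norm[of "{m, m'}" x] by simp

lemma norm_ell1_le:
  assumes "g summable_on UNIV" "\<And>m. cmod (cf x m) \<le> g m"
  shows "norm x \<le> infsum g UNIV"
  unfolding norm_ell1_def by (rule infsum_mono) (use assms cf_abs_summable in auto)

instance ell1 :: (type) banach
proof
  fix X :: "nat \<Rightarrow> 'a ell1"
  assume X: "Cauchy X"
  have "Cauchy (\<lambda>n. cf (X n) m)" for m
    unfolding Cauchy_def
  proof (intro allI impI)
    fix e :: real assume "e > 0"
    then obtain M where M: "\<And>n p. n \<ge> M \<Longrightarrow> p \<ge> M \<Longrightarrow> dist (X n) (X p) < e"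
      using X unfolding Cauchy_def by blast
    have "dist (cf (X n) m) (cf (X p) m) \<le> dist (X n) (X p)" for n p
      using cf_le_norm[of "X n - X p" m] by (simp add: dist_norm)
    then show "\<exists>M. \<forall>n\<ge>M. \<forall>p\<ge>M. dist (cf (X n) m) (cf (X p) m) < e"
      using M by (meson le_less_trans)
  qed
  then obtain L where L: "\<And>m. (\<lambda>n. cf (X n) m) \<longlonglongrightarrow> L m"
    by (meson Cauchy_convergent convergentD convergent_def)
  \<comment> \<open>For a fixed finite index set the Cauchy bound survives the limit in
    \<open>p\<close>. It does not depend on the set and therefore passes to the infinite
    sum.\<close>
  have bound: "(\<Sum>m\<in>F. cmod (cf (X n) m - L m)) \<le> e"
    if "finite F" and M: "\<And>p. p \<ge> M \<Longrightarrow> dist (X n) (X p) < e" for F n M e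
  proof (rule tendsto_upperbound)
    show "(\<lambda>p. \<Sum>m\<in>F. cmod (cf (X n) m - cf (X p) m)) \<longlonglongrightarrow> (\<Sum>m\<in>F. cmod (cf (X n) m - L m))"
      by (intro tendsto_intros L)
    show "\<forall>\<^sub>F p in sequentially. (\<Sum>m\<in>F. cmod (cf (X n) m - cf (X p) m)) \<le> e"
      using eventually_ge_at_top[of M]
    proof eventually_elim
      case (elim p)
      have "(\<Sum>m\<in>F. cmod (cf (X n - X p) m)) \<le> norm (X n - X p)"
        by (rule sum_cf_le_norm) fact
      then show ?case using M[OF elim] by (simp add: dist_norm)
    qed
  qed simp
  have summ: "(\<lambda>m. cf (X n) m - L m) abs_summable_on UNIV"
    if "\<And>p. p \<ge> M \<Longrightarrow> dist (X n) (X p) < e" for n M e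
    unfolding abs_summable_iff_bdd_above
    by (rule bdd_aboveI[of _ e]) (use bound that in auto)
  obtain N where "\<And>n p. n \<ge> N \<Longrightarrow> p \<ge> N \<Longrightarrow> dist (X n) (X p) < 1"
    using X unfolding Cauchy_def by (metis zero_less_one)
  then have D: "(\<lambda>m. cf (X N) m - L m) abs_summable_on UNIV" by (intro summ[of N N 1]) auto
  \<comment> \<open>Summability is known for the difference of \<open>X N\<close> and the pointwise
    limit \<open>L\<close>, not yet for \<open>L\<close> itself; the limit is therefore obtained by
    subtraction.\<close>
  define Y where "Y = X N - Abs_ell1 (\<lambda>m. cf (X N) m - L m)"
  have Y: "cf Y m = L m" for m by (simp add: Y_def cf_Abs[OF D])
  have "X \<longlonglongrightarrow> Y"
  proof (rule metric_LIMSEQ_I)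
    fix r :: real assume "r > 0"
    then have "r / 2 > 0" by simp
    then obtain M where M: "\<And>n p. n \<ge> M \<Longrightarrow> p \<ge> M \<Longrightarrow> dist (X n) (X p) < r / 2"
      using X unfolding Cauchy_def by meson
    have "dist (X n) Y < r" if "n \<ge> M" for n
    proof -
      have "(\<Sum>\<^sub>\<infinity>m. cmod (cf (X n) m - L m)) \<le> r / 2"
      proof (rule infsum_le_finite_sums)
        show "(\<lambda>m. cf (X n) m - L m) abs_summable_on UNIV"
          by (rule summ[of M n "r / 2"]) (rule M[OF that])
        show "(\<Sum>m\<in>F. cmod (cf (X n) m - L m)) \<le> r / 2" if "finite F" for F
          by (rule bound[of F M n "r / 2"]) (use M \<open>n \<ge> M\<close> that in blast)+
      qed
      then show ?thesis using \<open>r > 0\<close> by (simp add: dist_norm norm_ell1_def Y)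
    qed
    then show "\<exists>M. \<forall>n\<ge>M. dist (X n) Y < r" by blast
  qed
  then show "convergent X" by (rule convergentI)
qed

text \<open>A diagonal operator. For an unbounded symbol \<open>b\<close> the product family may
  fail to be summable, and \<open>Abs_ell1\<close> then has an unspecified value; hence the bound
  assumed in the next lemma.\<close>

definition multiplier :: "('a \<Rightarrow> complex) \<Rightarrow> 'a ell1 \<Rightarrow> 'a ell1" where
  "multiplier b x = Abs_ell1 (\<lambda>m. b m * cf x m)"

lemma
  assumes "\<And>m. cmod (b m) \<le> B"
  shows cf_multiplier: "cf (multiplier b x) m = b m * cf x m"
    and norm_multiplier: "norm (multiplier b x) \<le> B * norm x"
proof -
  have s: "(\<lambda>m. B * cmod (cf x m)) summable_on UNIV"
    by (intro summable_on_cmult_right cf_abs_summable)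
  have le: "cmod (b m * cf x m) \<le> B * cmod (cf x m)" for m
    by (simp add: norm_mult mult_right_mono assms)
  have c: "cf (multiplier b x) = (\<lambda>m. b m * cf x m)"
    unfolding multiplier_def
    by (rule cf_Abs) (rule Infinite_Sum.abs_summable_on_comparison_test'[OF s], rule le)
  then show "cf (multiplier b x) m = b m * cf x m" by simp
  show "norm (multiplier b x) \<le> B * norm x"
    using norm_ell1_le[OF s, of "multiplier b x"] le by (simp add: c norm_ell1_def infsum_cmult_right')
qed

lift_definition single :: "'a \<Rightarrow> complex \<Rightarrow> 'a ell1" is "\<lambda>r c m. if m = r then c else 0"
proof -
  fix r :: 'a and c :: complex
  have "(\<lambda>m. cmod (if m = r then c else 0)) summable_on {r}"
    by (rule summable_on_finite) simp
  then show "(\<lambda>m. if m = r then c else 0) abs_summable_on UNIV"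
    by (rule summable_on_cong_neutral[THEN iffD1, rotated -1]) auto
qed

declare single.rep_eq [simp]

lemma norm_single: "norm (single r c) = cmod c"
proof -
  have "norm (single r c) = (\<Sum>\<^sub>\<infinity>m\<in>{r}. cmod (cf (single r c) m))"
    unfolding norm_ell1_def by (rule infsum_cong_neutral) auto
  then show ?thesis by simp
qed

section \<open>Convolution and conjugation of coefficient families\<close>

lemma conv_abs_summable:
  fixes x y :: "'a::ab_group_add ell1"
  shows "(\<lambda>(k, m). cf x k * cf y (m - k)) abs_summable_on UNIV \<times> UNIV"
    and "(\<lambda>(k, m). cmod (cf x k * cf y (m - k))) summable_on UNIV \<times> UNIV"
    and "(\<Sum>\<^sub>\<infinity>k. \<Sum>\<^sub>\<infinity>m. cmod (cf x k * cf y (m - k))) = norm x * norm y"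
proof -
  \<comment> \<open>For fixed \<open>k\<close> the inner sum runs over a translate of the family of
    \<open>y\<close>, which produces the product of the norms. Summability over pairs later licenses
    the exchange of sums in \<open>norm_conv\<close> and \<open>eval_conv\<close>.\<close>
  have bij: "bij_betw (\<lambda>m. m - k) UNIV UNIV" for k :: 'a
    by (rule bij_betw_byWitness[of _ "\<lambda>m. m + k"]) auto
  have shift: "(\<lambda>m. cmod (cf y (m - k))) summable_on UNIV"
    "(\<Sum>\<^sub>\<infinity>m. cmod (cf y (m - k))) = norm y" for k
    using summable_on_reindex_bij_betw[OF bij, of "\<lambda>m. cmod (cf y m)"] cf_abs_summable[of y]
      infsum_reindex_bij_betw[OF bij, of "\<lambda>m. cmod (cf y m)"] by (auto simp: norm_ell1_def)
  have inner: "(\<Sum>\<^sub>\<infinity>m. cmod (cf x k * cf y (m - k))) = cmod (cf x k) * norm y" for k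
    by (simp add: norm_mult infsum_cmult_right' shift)
  show 1: "(\<lambda>(k, m). cf x k * cf y (m - k)) abs_summable_on UNIV \<times> UNIV"
    unfolding Infinite_Sum.abs_summable_on_Sigma_iff
    using summable_on_cmult_left[OF cf_abs_summable[of x], of "norm y"]
    by (simp add: inner abs_mult) (auto simp: norm_mult intro!: summable_on_cmult_right shift)
  then show "(\<lambda>(k, m). cmod (cf x k * cf y (m - k))) summable_on UNIV \<times> UNIV"
    by (simp add: case_prod_unfold)
  show "(\<Sum>\<^sub>\<infinity>k. \<Sum>\<^sub>\<infinity>m. cmod (cf x k * cf y (m - k))) = norm x * norm y"
    by (simp add: inner infsum_cmult_left' norm_ell1_def)
qed

definition conv :: "'a::ab_group_add ell1 \<Rightarrow> 'a ell1 \<Rightarrow> 'a ell1" where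
  "conv x y = Abs_ell1 (\<lambda>m. \<Sum>\<^sub>\<infinity>k. cf x k * cf y (m - k))"

lemma conv_term_abs_summable:
  fixes x y :: "'a::ab_group_add ell1"
  shows "(\<lambda>k. cf x k * cf y (m - k)) abs_summable_on UNIV"
  by (rule Infinite_Sum.abs_summable_on_comparison_test'[where g = "\<lambda>k. cmod (cf x k) * norm y"])
     (auto simp: norm_mult intro!: summable_on_cmult_left cf_abs_summable mult_left_mono cf_le_norm)

lemma cf_conv: "cf (conv x y) m = (\<Sum>\<^sub>\<infinity>k. cf x k * cf y (m - k))"
  and norm_conv: "norm (conv x y) \<le> norm x * norm y"
proof -
  define s where "s = (\<lambda>m. \<Sum>\<^sub>\<infinity>k. cmod (cf x k * cf y (m - k)))"
  have swap: "(\<lambda>(m, k). cmod (cf x k * cf y (m - k))) summable_on UNIV \<times> UNIV"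
    using conv_abs_summable(2)[of x y]
      summable_on_reindex_bij_betw[of prod.swap "UNIV \<times> UNIV" "UNIV \<times> UNIV"
        "\<lambda>(k, m). cmod (cf x k * cf y (m - k))"]
    by (simp add: case_prod_unfold bij_betw_def product_swap)
  have s: "s summable_on UNIV"
    unfolding s_def using summable_on_Sigma_banach[OF swap] .
  have le: "cmod (\<Sum>\<^sub>\<infinity>k. cf x k * cf y (m - k)) \<le> s m" for m
    unfolding s_def by (rule norm_infsum_bound[OF conv_term_abs_summable])
  have c: "cf (conv x y) = (\<lambda>m. \<Sum>\<^sub>\<infinity>k. cf x k * cf y (m - k))"
    unfolding conv_def by (rule cf_Abs, rule Infinite_Sum.abs_summable_on_comparison_test'[OF s]) (rule le)
  then show "cf (conv x y) m = (\<Sum>\<^sub>\<infinity>k. cf x k * cf y (m - k))" by simp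
  have "norm (conv x y) \<le> infsum s UNIV"
    by (rule norm_ell1_le[OF s]) (simp add: c le)
  also have "\<dots> = norm x * norm y"
    unfolding s_def conv_abs_summable(3)[symmetric]
    by (rule infsum_swap_banach[OF swap])
  finally show "norm (conv x y) \<le> norm x * norm y" .
qed

lemma cf_conv_single: "cf (conv x (single r c)) m = cf x (m - r) * c"
proof -
  have "cf (conv x (single r c)) m = (\<Sum>\<^sub>\<infinity>k\<in>{m - r}. cf x k * cf (single r c) (m - k))"
    unfolding cf_conv by (rule infsum_cong_neutral) (auto simp: algebra_simps)
  then show ?thesis by simp
qed

lemma bounded_bilinear_conv: "bounded_bilinear (conv :: 'a::ab_group_add ell1 \<Rightarrow> _)"
proof
  fix x x' y y' :: "'a ell1" and r :: real
  note s = abs_summable_summable[OF conv_term_abs_summable]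
  show "conv (x + x') y = conv x y + conv x' y" "conv x (y + y') = conv x y + conv x y'"
    by (rule ell1_eqI; simp add: cf_conv distrib_left distrib_right infsum_add s)+
  show "conv (r *\<^sub>R x) y = r *\<^sub>R conv x y" "conv x (r *\<^sub>R y) = r *\<^sub>R conv x y"
    by (rule ell1_eqI; simp add: cf_conv mult.assoc mult.left_commute[of _ "of_real r"] infsum_cmult_right')+
  show "\<exists>K. \<forall>x y :: 'a ell1. norm (conv x y) \<le> norm x * norm y * K"
    by (rule exI[of _ 1]) (simp add: norm_conv)
qed

text \<open>The coefficient side of pointwise complex conjugation, see \<open>eval_star\<close>; the
  reflected index comes from conjugating the exponentials.\<close>

lift_definition star :: "'a::ab_group_add ell1 \<Rightarrow> 'a ell1" is "\<lambda>x m. cnj (x (- m))"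
proof -
  fix x :: "'a \<Rightarrow> complex"
  assume "x abs_summable_on UNIV"
  then show "(\<lambda>m. cnj (x (- m))) abs_summable_on UNIV"
    using summable_on_reindex_bij_betw[of uminus UNIV UNIV "\<lambda>m. cmod (x m)"]
    by (simp add: bij_uminus)
qed

declare star.rep_eq [simp]

lemma norm_star: "norm (star x) = norm x"
  using infsum_reindex_bij_betw[of uminus UNIV UNIV "\<lambda>m. cmod (cf x m)"]
  by (simp add: norm_ell1_def bij_uminus)

lemma star_diff: "star (x - y) = star x - star y"
  by (rule ell1_eqI) simp


section \<open>Absolutely convergent Fourier series\<close>

lemma rvec_simps [simp]: "rvec (m + m') = rvec m + rvec m'" "rvec (m - m') = rvec m - rvec m'"
  "rvec (- m) = - rvec m" "rvec 0 = 0"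
  by (simp_all add: rvec_def vec_eq_iff)

section \<open>Orthogonality of the exponentials on the cell\<close>

lemma integral_cis_interval:
  assumes "(k::int) \<noteq> 0"
  shows "(\<integral>x\<in>{0..2*pi}. cis (of_int k * x) \<partial>lborel) = 0"
proof -
  have "((\<lambda>x. cis (of_int k * x)) has_integral
      cis (of_int k * (2*pi)) / (\<i> * of_int k) - cis (of_int k * 0) / (\<i> * of_int k)) {0..2*pi}"
  proof (rule fundamental_theorem_of_calculus)
    fix x
    show "((\<lambda>x. cis (of_int k * x) / (\<i> * of_int k)) has_vector_derivative cis (of_int k * x))
        (at x within {0..2*pi})"
    proof -
      have "((\<lambda>z. exp (\<i> * (of_int k * z)) / (\<i> * of_int k)) has_field_derivative
          exp (\<i> * (of_int k * of_real x))) (at (of_real x))"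
        by (auto intro!: derivative_eq_intros simp: assms field_simps)
      from has_vector_derivative_real_field[OF this] show ?thesis
        by (simp add: cis_conv_exp)
    qed
  qed simp
  moreover have "cis (of_int k * (2*pi)) = 1"
    using cis_multiple_2pi[of "of_int k"] by (simp add: mult_ac)
  ultimately have "integral {0..2*pi} (\<lambda>x. cis (of_int k * x)) = 0" by (simp add: integral_unique)
  then show ?thesis
    by (subst set_borel_integral_eq_integral)
       (auto intro!: borel_integrable_atLeastAtMost' continuous_intros)
qed

lemma cis_sum: "finite A \<Longrightarrow> cis (sum f A) = (\<Prod>a\<in>A. cis (f a))"
  by (induction rule: finite_induct) (auto simp: cis_mult[symmetric])

text \<open>The exponential and the indicator of the cell are both products over the coordinates, so
  the integral is a product of one-dimensional integrals. A coordinate with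
  \<open>m $ s \<noteq> 0\<close> contributes a vanishing factor.\<close>

lemma integral_cis_box:
  fixes m :: "int ^ 'n::finite"
  shows "integral (cbox 0 (\<chi> s. 2 * pi)) (\<lambda>x. cis (rvec m \<bullet> x)) = (if m = 0 then (2 * pi) ^ CARD('n) else 0)"
proof (cases "m = 0")
  case True
  then show ?thesis
    using content_cbox_cart[of 0 "\<chi> s :: 'n. 2 * pi"]
    by (simp add: interval_eq_empty_cart not_less scaleR_conv_of_real)
next
  case False
  then obtain s where s: "m $ s \<noteq> 0" by (auto simp: vec_eq_iff)
  let ?B = "cbox 0 (\<chi> s. 2 * pi) :: (real ^ 'n) set"
  define F where "F = (\<lambda>(b :: real ^ 'n) x. indicator {0..2*pi} x *\<^sub>R cis ((rvec m \<bullet> b) * x))"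
  have int: "set_integrable lborel ?B (\<lambda>x. cis (rvec m \<bullet> x))"
    unfolding set_integrable_def by (rule borel_integrable_compact) (auto intro!: continuous_intros)
  have F: "integrable lborel (F b)" for b
    using borel_integrable_atLeastAtMost'[of 0 "2*pi" "\<lambda>x. cis ((rvec m \<bullet> b) * x)"]
    unfolding F_def set_integrable_def by (simp add: continuous_intros)
  have "integral ?B (\<lambda>x. cis (rvec m \<bullet> x)) = (\<integral>x\<in>?B. cis (rvec m \<bullet> x) \<partial>lborel)"
    using set_borel_integral_eq_integral(2)[OF int] by simp
  also have "\<dots> = (\<integral>x. (\<Prod>b\<in>Basis. F b (x \<bullet> b)) \<partial>lborel)"
    unfolding set_lebesgue_integral_def
  proof (rule Bochner_Integration.integral_cong)
    fix x :: "real ^ 'n"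
    have "indicator ?B x = (\<Prod>b\<in>Basis. indicator {0..2*pi} (x \<bullet> b) :: real)"
    proof (cases "x \<in> ?B")
      case True
      then have "\<forall>b\<in>Basis. x \<bullet> b \<in> {0..2*pi}"
        by (auto simp: mem_box Basis_vec_def inner_axis)
      then show ?thesis using True by (simp add: prod.neutral)
    next
      case False
      then have "\<exists>b\<in>Basis. x \<bullet> b \<notin> {0..2*pi}"
        by (auto simp: mem_box Basis_vec_def inner_axis)
      then show ?thesis using False by (auto simp: indicator_def intro!: prod_zero[symmetric])
    qed
    moreover have "cis (rvec m \<bullet> x) = (\<Prod>b\<in>Basis. cis ((rvec m \<bullet> b) * (x \<bullet> b)))"
      by (subst euclidean_inner) (simp add: cis_sum)
    ultimately show "indicator ?B x *\<^sub>R cis (rvec m \<bullet> x) = (\<Prod>b\<in>Basis. F b (x \<bullet> b))"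
      by (simp add: F_def scaleR_conv_of_real prod.distrib)
  qed simp
  also have "\<dots> = (\<integral>f. (\<Prod>b\<in>Basis. F b (f b)) \<partial>(\<Pi>\<^sub>M b\<in>(Basis :: (real ^ 'n) set). lborel))"
  proof (subst lborel_eq, subst integral_distr)
    show "(\<lambda>x. \<Prod>b\<in>Basis. F b (x \<bullet> b)) \<in> borel_measurable (borel :: (real ^ 'n) measure)"
      unfolding F_def cis_conv_exp by measurable
  qed (auto intro!: Bochner_Integration.integral_cong prod.cong)
  also have "\<dots> = (\<Prod>b\<in>(Basis :: (real ^ 'n) set). \<integral>x. F b x \<partial>lborel)"
  proof -
    interpret product_sigma_finite "\<lambda>_ :: real ^ 'n. lborel :: real measure" ..
    show ?thesis by (rule product_integral_prod) (auto intro: F)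
  qed
  also have "\<dots> = 0"
  proof (rule prod_zero)
    have "(\<integral>x. F (axis s 1) x \<partial>lborel) = 0"
      using integral_cis_interval[OF s]
      by (simp add: F_def set_lebesgue_integral_def inner_axis rvec_def)
    then show "\<exists>b\<in>(Basis :: (real ^ 'n) set). (\<integral>x. F b x \<partial>lborel) = 0"
      by (intro bexI[of _ "axis s 1"]) (auto simp: axis_in_Basis_iff)
  qed simp
  finally show ?thesis using False by simp
qed

text \<open>The frequencies are arbitrary so that the same lemmas serve periodic sums
  (\<open>rvec\<close>), quasi-periodic sums (\<open>Pvec (j + m) t\<close>) and the shifted sums
  that appear under the integral of a Fourier coefficient.\<close>

definition expsum :: "('i \<Rightarrow> real ^ 'n) \<Rightarrow> ('i \<Rightarrow> complex) \<Rightarrow> real ^ 'n::finite \<Rightarrow> complex" where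
  "expsum \<omega> a x = (\<Sum>\<^sub>\<infinity>m. a m * cis (\<omega> m \<bullet> x))"

lemma expsum_term_summable:
  assumes "a abs_summable_on UNIV"
  shows "(\<lambda>m. a m * cis (\<omega> m \<bullet> x)) abs_summable_on UNIV"
    and "(\<lambda>m. a m * cis (\<omega> m \<bullet> x)) summable_on UNIV"
proof -
  show "(\<lambda>m. a m * cis (\<omega> m \<bullet> x)) abs_summable_on UNIV"
    using assms by (simp add: norm_mult)
  then show "(\<lambda>m. a m * cis (\<omega> m \<bullet> x)) summable_on UNIV" by (rule abs_summable_summable)
qed

lemma expsum_uniform_limit:
  assumes "a abs_summable_on UNIV"
  shows "uniform_limit S (\<lambda>F x. \<Sum>m\<in>F. a m * cis (\<omega> m \<bullet> x)) (expsum \<omega> a) (finite_subsets_at_top UNIV)"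
  unfolding expsum_def
  by (rule Weierstrass_m_test_general[OF _ assms]) (simp add: norm_mult)

lemma continuous_on_expsum:
  assumes "a abs_summable_on UNIV"
  shows "continuous_on S (expsum \<omega> a)"
  by (rule uniform_limit_theorem[OF _ expsum_uniform_limit[OF assms]])
     (auto intro!: always_eventually continuous_intros)

definition eval :: "(int ^ 'n) ell1 \<Rightarrow> real ^ 'n::finite \<Rightarrow> complex" where
  "eval x = expsum rvec (cf x)"

lemma eval_add: "eval (x + y) \<theta> = eval x \<theta> + eval y \<theta>"
  and eval_scaleR: "eval (r *\<^sub>R x) \<theta> = of_real r * eval x \<theta>"
  unfolding eval_def expsum_def
  by (simp_all add: distrib_right infsum_add mult.assoc infsum_cmult_right'
      expsum_term_summable[OF cf_abs_summable])

lemma eval_diff: "eval (x - y) \<theta> = eval x \<theta> - eval y \<theta>"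
  using eval_add[of x "(-1) *\<^sub>R y" \<theta>] eval_scaleR[of "-1" y \<theta>] by simp

lemma eval_single: "eval (single r c) \<theta> = c * cis (rvec r \<bullet> \<theta>)"
proof -
  have "eval (single r c) \<theta> = (\<Sum>\<^sub>\<infinity>m\<in>{r}. cf (single r c) m * cis (rvec m \<bullet> \<theta>))"
    unfolding eval_def expsum_def by (rule infsum_cong_neutral) auto
  then show ?thesis by simp
qed

lemma eval_star: "eval (star x) \<theta> = cnj (eval x \<theta>)"
proof -
  have "eval (star x) \<theta> = (\<Sum>\<^sub>\<infinity>m. cnj (cf x (- m) * cis (rvec (- m) \<bullet> \<theta>)))"
    unfolding eval_def expsum_def by (simp add: cis_cnj)
  also have "\<dots> = (\<Sum>\<^sub>\<infinity>m. cnj (cf x m * cis (rvec m \<bullet> \<theta>)))"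
    by (rule infsum_reindex_bij_betw[of uminus UNIV UNIV "\<lambda>m. cnj (cf x m * cis (rvec m \<bullet> \<theta>))"])
       (rule bij_uminus)
  finally show ?thesis unfolding eval_def expsum_def by (simp only: infsum_cnj)
qed

lemma eval_conv: "eval (conv x y) \<theta> = eval x \<theta> * eval y \<theta>"
proof -
  let ?e = "\<lambda>m. cis (rvec m \<bullet> \<theta>)"
  have "(\<lambda>(k, m). cf x k * cf y (m - k) * ?e m) abs_summable_on UNIV \<times> UNIV"
    using conv_abs_summable(2)[of x y] by (simp add: case_prod_unfold norm_mult)
  then have S: "(\<lambda>(k, m). cf x k * cf y (m - k) * ?e m) summable_on UNIV \<times> UNIV"
    by (rule abs_summable_summable)
  have "eval (conv x y) \<theta> = (\<Sum>\<^sub>\<infinity>m. \<Sum>\<^sub>\<infinity>k. cf x k * cf y (m - k) * ?e m)"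
    unfolding eval_def expsum_def cf_conv by (simp add: infsum_cmult_left')
  also have "\<dots> = (\<Sum>\<^sub>\<infinity>k. \<Sum>\<^sub>\<infinity>m. cf x k * cf y (m - k) * ?e m)"
    by (rule infsum_swap_banach[OF S, symmetric])
  also have "\<dots> = (\<Sum>\<^sub>\<infinity>k. cf x k * ?e k * eval y \<theta>)"
  proof (rule infsum_cong)
    fix k
    have "(\<Sum>\<^sub>\<infinity>m. cf x k * cf y (m - k) * ?e m)
        = (\<Sum>\<^sub>\<infinity>m. cf x k * ?e k * (cf y (m - k) * ?e (m - k)))"
      by (rule infsum_cong) (simp add: inner_diff_left cis_divide[symmetric])
    also have "\<dots> = (\<Sum>\<^sub>\<infinity>m. cf x k * ?e k * (cf y m * ?e m))"
      by (rule infsum_reindex_bij_betw[of "\<lambda>m. m - k" UNIV UNIV "\<lambda>m. cf x k * ?e k * (cf y m * ?e m)"])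
         (rule bij_betw_byWitness[of _ "\<lambda>m. m + k"], auto)
    finally show "(\<Sum>\<^sub>\<infinity>m. cf x k * cf y (m - k) * ?e m) = cf x k * ?e k * eval y \<theta>"
      unfolding eval_def expsum_def by (simp add: infsum_cmult_right')
  qed
  also have "\<dots> = eval x \<theta> * eval y \<theta>"
    unfolding eval_def[of x] expsum_def by (rule infsum_cmult_left')
  finally show ?thesis .
qed

lemma periodic_eval:
  fixes x :: "(int ^ 'n::finite) ell1"
  shows "periodic (eval x)"
proof -
  have *: "cis (of_int i * (pi * 2)) = 1" for i :: int
    using cis_multiple_2pi[of "of_int i"] by (simp add: mult_ac)
  have "cis (rvec m \<bullet> (\<theta> + (2 * pi) *\<^sub>R axis s 1)) = cis (rvec m \<bullet> \<theta>)" for m :: "int ^ 'n" and \<theta> s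
    by (simp add: inner_add_right inner_axis rvec_def mult.commute * flip: cis_mult)
  then show ?thesis by (simp add: periodic_def eval_def expsum_def)
qed

text \<open>Uniform convergence of the partial sums permits termwise integration. By orthogonality
  the integral of a partial sum no longer changes once its index set contains \<open>m\<close>, so
  the net of integrals is eventually constant.\<close>

lemma fourier_coeff_eval:
  fixes x :: "(int ^ 'n::finite) ell1"
  shows "fourier_coeff (eval x) m = cf x m"
proof -
  let ?B = "cbox 0 (\<chi> s. 2 * pi) :: (real ^ 'n) set"
  let ?a = "\<lambda>k. cf x k"
  let ?f = "\<lambda>F \<theta>. \<Sum>k\<in>F. ?a k * cis (rvec (k - m) \<bullet> \<theta>)"
  have u: "uniform_limit ?B ?f (expsum (\<lambda>k. rvec (k - m)) ?a) (finite_subsets_at_top UNIV)"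
    by (rule expsum_uniform_limit[OF cf_abs_summable])
  have g: "expsum (\<lambda>k. rvec (k - m)) ?a = (\<lambda>\<theta>. eval x \<theta> * cis (- (rvec m \<bullet> \<theta>)))"
    unfolding expsum_def eval_def
    by (simp add: inner_diff_left mult.assoc cis_mult flip: infsum_cmult_left')
  obtain I J where I: "\<And>F. (?f F has_integral I F) ?B"
    and J: "(expsum (\<lambda>k. rvec (k - m)) ?a has_integral J) ?B"
    and lim: "(I \<longlongrightarrow> J) (finite_subsets_at_top UNIV)"
    by (rule uniform_limit_integral_cbox[OF u]) (auto intro!: continuous_intros)
  have If: "I F = (if m \<in> F then ?a m * (2 * pi) ^ CARD('n) else 0)" if "finite F" for F
  proof -
    have "I F = integral ?B (?f F)" by (rule integral_unique[OF I, symmetric])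
    also have "\<dots> = (\<Sum>k\<in>F. ?a k * integral ?B (\<lambda>\<theta>. cis (rvec (k - m) \<bullet> \<theta>)))"
      using that by (subst integral_sum)
        (auto intro!: integrable_continuous continuous_intros simp: integral_mult_right simp del: rvec_simps)
    also have "\<dots> = (\<Sum>k\<in>F. if k = m then ?a m * (2 * pi) ^ CARD('n) else 0)"
      unfolding integral_cis_box by (rule sum.cong) auto
    finally show ?thesis using that by simp
  qed
  have "\<forall>\<^sub>F F in finite_subsets_at_top UNIV. I F = ?a m * (2 * pi) ^ CARD('n)"
    unfolding eventually_finite_subsets_at_top
    by (rule exI[of _ "{m}"]) (auto simp: If)
  then have "(I \<longlongrightarrow> ?a m * (2 * pi) ^ CARD('n)) (finite_subsets_at_top UNIV)"
    by (rule tendsto_eventually)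
  then have "J = ?a m * (2 * pi) ^ CARD('n)"
    using lim by (intro tendsto_unique[OF _ lim]) auto
  then show ?thesis
    using J unfolding fourier_coeff_def g by (simp add: integral_unique)
qed

text \<open>The bridge from the \<open>ennreal\<close>-valued norm of the statement to the real norm
  in which the contraction is carried out: both are suprema of the same finite sums.\<close>

lemma star_norm_eval: "star_norm (eval x) = ennreal (norm x)"
proof -
  have "star_norm (eval x) = (SUP F\<in>{F. finite F \<and> F \<subseteq> UNIV}. \<Sum>m\<in>F. ennreal (cmod (cf x m)))"
    unfolding star_norm_def fourier_coeff_eval by (rule nonneg_infsum_complete) simp
  also have "\<dots> = ennreal (norm x)"
    unfolding norm_ell1_def infsum_nonneg_is_SUPREMUM_ennreal[OF cf_abs_summable norm_ge_zero]
    by (simp add: sum_ennreal)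
  finally show ?thesis .
qed

lemma fourier_coeff_cnj:
  "fourier_coeff (\<lambda>x. cnj (W x)) m = cnj (fourier_coeff W (- m))"
proof -
  have "integral (cbox 0 (\<chi> s. 2 * pi)) (\<lambda>x. cnj (W x) * cis (- (rvec m \<bullet> x)))
      = cnj (integral (cbox 0 (\<chi> s. 2 * pi)) (\<lambda>x. W x * cis (- (rvec (- m) \<bullet> x))))"
    by (simp add: integral_cnj cis_cnj)
  then show ?thesis by (simp add: fourier_coeff_def)
qed

text \<open>Coefficient 0 is a mean value. This turns pointwise reality of a density into reality of
  a pairing of coefficient families, which is how the imaginary part of the eigenvalue equation is
  controlled.\<close>

lemma cf_0_real:
  assumes "\<And>\<theta>. eval x \<theta> \<in> \<real>"
  shows "cf x 0 \<in> \<real>"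
proof -
  have "eval x = (\<lambda>\<theta>. cnj (eval x \<theta>))" using assms by (simp add: Reals_cnj_iff)
  then have "fourier_coeff (eval x) 0 = cnj (fourier_coeff (eval x) (- 0))"
    using fourier_coeff_cnj by metis
  then show ?thesis by (simp add: fourier_coeff_eval Reals_cnj_iff)
qed


section \<open>Differentiability of exponential sums\<close>

text \<open>With difference quotients, differentiating a series becomes a question of interchanging
  two limits.\<close>

lemma has_vector_derivative_at_0_iff:
  fixes g :: "real \<Rightarrow> complex"
  shows "(g has_vector_derivative D) (at 0) \<longleftrightarrow> ((\<lambda>h. (g h - g 0) / of_real h) \<longlongrightarrow> D) (at 0)"
proof -
  have "(g has_vector_derivative D) (at 0) \<longleftrightarrow>
      ((\<lambda>h. norm (g h - g 0 - h *\<^sub>R D) / \<bar>h\<bar>) \<longlongrightarrow> 0) (at 0)"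
    unfolding has_vector_derivative_def has_derivative_iff_norm
    by (simp add: bounded_linear_scaleR_left)
  also have "\<dots> \<longleftrightarrow> ((\<lambda>h. norm ((g h - g 0) / of_real h - D)) \<longlongrightarrow> 0) (at 0)"
  proof (rule LIM_cong)
    fix h :: real assume "h \<noteq> 0"
    then have "(g h - g 0) / of_real h - D = (g h - g 0 - h *\<^sub>R D) / of_real h"
      by (simp add: field_simps scaleR_conv_of_real)
    then show "norm (g h - g 0 - h *\<^sub>R D) / \<bar>h\<bar> = norm ((g h - g 0) / of_real h - D)"
      by (simp add: norm_divide)
  qed simp_all
  finally show ?thesis by (simp only: tendsto_norm_zero_iff LIM_zero_iff)
qed

lemma difference_quotient_cis_tendsto:
  "((\<lambda>h::real. (cis (w * h) - 1) / of_real h) \<longlongrightarrow> \<i> * of_real w) (at 0)"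
proof -
  have "((\<lambda>z. exp (\<i> * (of_real w * z))) has_field_derivative \<i> * of_real w) (at (of_real 0))"
    by (auto intro!: derivative_eq_intros)
  from has_vector_derivative_real_field[OF this]
  have "((\<lambda>h. cis (w * h)) has_vector_derivative \<i> * of_real w) (at 0)"
    by (simp add: cis_conv_exp)
  then show ?thesis by (simp add: has_vector_derivative_at_0_iff)
qed

text \<open>The chord is no longer than the arc. The bound includes \<open>h = 0\<close>, where the
  quotient is 0 by convention, so the M-test can run over the whole real line.\<close>

lemma cmod_difference_quotient_cis: "cmod ((cis (w * h) - 1) / of_real h) \<le> \<bar>w\<bar>"
proof -
  have "cmod (cis (w * h) - 1) = 2 * \<bar>sin (w * h / 2)\<bar>"
    using dist_exp_i_1[of "w * h"] by (simp add: cis_conv_exp)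
  also have "\<dots> \<le> \<bar>w\<bar> * \<bar>h\<bar>"
    using abs_sin_x_le_abs_x[of "w * h / 2"] by (simp add: abs_mult)
  finally show ?thesis
    by (cases "h = 0") (simp_all add: norm_divide divide_le_eq)
qed

text \<open>The difference quotients of the terms are dominated, uniformly in \<open>h\<close>, by
  the summable family of assumption \<open>b\<close>. The quotients of the partial sums thus
  converge uniformly, and the limit in \<open>h\<close> may be exchanged with the sum.\<close>

lemma expsum_has_partial:
  assumes a: "a abs_summable_on UNIV" and b: "(\<lambda>m. norm (\<omega> m) * cmod (a m)) summable_on UNIV"
  shows "((\<lambda>h::real. expsum \<omega> a (x + h *\<^sub>R axis s 1)) has_vector_derivative
      expsum \<omega> (\<lambda>m. \<i> * of_real (\<omega> m $ s) * a m) x) (at 0)"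
proof -
  define q where "q m h = a m * cis (\<omega> m \<bullet> x) * ((cis (\<omega> m $ s * h) - 1) / of_real h)" for m and h :: real
  have shift: "cis (\<omega> m \<bullet> (x + h *\<^sub>R axis s 1)) = cis (\<omega> m \<bullet> x) * cis (\<omega> m $ s * h)" for m h
    by (simp add: inner_add_right inner_axis cis_mult mult.commute)
  have q: "(expsum \<omega> a (x + h *\<^sub>R axis s 1) - expsum \<omega> a x) / of_real h = (\<Sum>\<^sub>\<infinity>m. q m h)" for h
  proof -
    have "expsum \<omega> a (x + h *\<^sub>R axis s 1) - expsum \<omega> a x
        = (\<Sum>\<^sub>\<infinity>m. a m * cis (\<omega> m \<bullet> (x + h *\<^sub>R axis s 1)) + - (a m * cis (\<omega> m \<bullet> x)))"
      unfolding expsum_def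
      by (subst infsum_add) (simp_all add: expsum_term_summable[OF a] infsum_uminus summable_on_uminus)
    then have "(expsum \<omega> a (x + h *\<^sub>R axis s 1) - expsum \<omega> a x) / of_real h
        = (\<Sum>\<^sub>\<infinity>m. (a m * cis (\<omega> m \<bullet> (x + h *\<^sub>R axis s 1)) + - (a m * cis (\<omega> m \<bullet> x))) * inverse (of_real h))"
      by (simp add: infsum_cmult_left' divide_inverse)
    also have "(\<lambda>m. (a m * cis (\<omega> m \<bullet> (x + h *\<^sub>R axis s 1)) + - (a m * cis (\<omega> m \<bullet> x))) * inverse (of_real h))
        = (\<lambda>m. q m h)"
      unfolding q_def shift by (simp add: divide_inverse algebra_simps)
    finally show ?thesis .
  qed
  have le: "\<bar>\<omega> m $ s\<bar> * cmod (a m) \<le> norm (\<omega> m) * cmod (a m)" for m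
    by (rule mult_right_mono[OF component_le_norm_cart]) simp
  have "cmod (q m h) \<le> norm (\<omega> m) * cmod (a m)" for m h
    using mult_left_mono[OF cmod_difference_quotient_cis[of "\<omega> m $ s" h], of "cmod (a m)"] le[of m]
    by (simp add: q_def norm_mult norm_divide mult.commute)
  then have u: "uniform_limit UNIV (\<lambda>F h. \<Sum>m\<in>F. q m h) (\<lambda>h. \<Sum>\<^sub>\<infinity>m. q m h) (finite_subsets_at_top UNIV)"
    using b by (intro Weierstrass_m_test_general) auto
  have "(\<lambda>m. \<i> * of_real (\<omega> m $ s) * a m) abs_summable_on UNIV"
    by (rule Infinite_Sum.abs_summable_on_comparison_test'[OF b]) (simp add: norm_mult le)
  from infsum_tendsto[OF expsum_term_summable(2)[OF this, of \<omega> x]]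
  have l: "((\<lambda>F. \<Sum>m\<in>F. \<i> * of_real (\<omega> m $ s) * a m * cis (\<omega> m \<bullet> x))
      \<longlongrightarrow> expsum \<omega> (\<lambda>m. \<i> * of_real (\<omega> m $ s) * a m) x) (finite_subsets_at_top UNIV)"
    by (simp add: expsum_def)
  have "(q m \<longlongrightarrow> \<i> * of_real (\<omega> m $ s) * a m * cis (\<omega> m \<bullet> x)) (at 0)" for m
    unfolding q_def
    using tendsto_mult_left[OF difference_quotient_cis_tendsto, of "a m * cis (\<omega> m \<bullet> x)" "\<omega> m $ s"]
    by (simp add: mult_ac)
  then have "((\<lambda>h. \<Sum>\<^sub>\<infinity>m. q m h) \<longlongrightarrow> expsum \<omega> (\<lambda>m. \<i> * of_real (\<omega> m $ s) * a m) x) (at 0)"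
    by (intro swap_uniform_limit'[OF _ l u] always_eventually allI tendsto_sum) auto
  then show ?thesis by (simp add: has_vector_derivative_at_0_iff q)
qed

section \<open>Smoothness and derivatives in terms of moments of the coefficients\<close>

lemma abs_summable_le:
  assumes "g summable_on (UNIV :: 'a set)" "\<And>m. cmod (f m) \<le> g m"
  shows "f abs_summable_on (UNIV :: 'a set)"
  using assms by (rule Infinite_Sum.abs_summable_on_comparison_test')

context
  fixes \<omega> :: "'i \<Rightarrow> real ^ 'n::finite"
begin

text \<open>The weight is at least 1 also at small frequencies, so a moment controls all lower ones
  and absolute summability itself.\<close>

definition moment_summable :: "nat \<Rightarrow> ('i \<Rightarrow> complex) \<Rightarrow> bool" where
  "moment_summable r a \<longleftrightarrow> (\<lambda>m. (1 + norm (\<omega> m)) ^ r * cmod (a m)) summable_on UNIV"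

text \<open>Multiplying the coefficients by a symbol that grows like a power of the frequency costs
  that many moments. The case \<open>b = a\<close> lowers the order.\<close>

lemma moment_summable_mono:
  assumes "moment_summable r a" "r' \<le> r" "\<And>m. cmod (b m) \<le> (1 + norm (\<omega> m)) ^ (r - r') * cmod (a m)"
  shows "moment_summable r' b"
proof -
  have "(\<lambda>m. of_real ((1 + norm (\<omega> m)) ^ r') * b m) abs_summable_on UNIV"
  proof (rule abs_summable_le)
    show "(\<lambda>m. (1 + norm (\<omega> m)) ^ r * cmod (a m)) summable_on UNIV"
      using assms(1) by (simp add: moment_summable_def)
    fix m
    have "cmod (of_real ((1 + norm (\<omega> m)) ^ r') * b m) = (1 + norm (\<omega> m)) ^ r' * cmod (b m)"
      by (simp only: norm_mult norm_of_real) simp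
    also have "\<dots> \<le> (1 + norm (\<omega> m)) ^ r' * ((1 + norm (\<omega> m)) ^ (r - r') * cmod (a m))"
      by (intro mult_left_mono assms) simp
    also have "\<dots> = (1 + norm (\<omega> m)) ^ r * cmod (a m)"
      using assms(2) by (simp flip: mult.assoc power_add)
    finally show "cmod (of_real ((1 + norm (\<omega> m)) ^ r') * b m) \<le> (1 + norm (\<omega> m)) ^ r * cmod (a m)" .
  qed
  moreover have "cmod (of_real ((1 + norm (\<omega> m)) ^ r') * b m) = (1 + norm (\<omega> m)) ^ r' * cmod (b m)" for m
    by (simp only: norm_mult norm_of_real) simp
  ultimately show ?thesis
    by (simp only: moment_summable_def)
qed

lemma moment_summable_0: "moment_summable r a \<Longrightarrow> a abs_summable_on UNIV"
  using moment_summable_mono[of r a 0 a] by (simp add: moment_summable_def mult_le_cancel_right1)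

lemma moment_summable_frequency:
  assumes "moment_summable (Suc r) a"
  shows "moment_summable r (\<lambda>m. \<i> * of_real (\<omega> m $ s) * a m)"
proof (rule moment_summable_mono[OF assms])
  show "cmod (\<i> * of_real (\<omega> m $ s) * a m) \<le> (1 + norm (\<omega> m)) ^ (Suc r - r) * cmod (a m)" for m
    using component_le_norm_cart[of "\<omega> m" s]
    by (auto simp: norm_mult intro!: mult_right_mono)
qed simp

lemma expsum_partial:
  assumes "moment_summable (Suc r) a"
  shows "partial s (expsum \<omega> a) = expsum \<omega> (\<lambda>m. \<i> * of_real (\<omega> m $ s) * a m)"
    and "(\<lambda>h::real. expsum \<omega> a (x + h *\<^sub>R axis s 1)) differentiable (at 0)"
proof -
  have "moment_summable r (\<lambda>m. of_real (norm (\<omega> m)) * a m)"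
    by (rule moment_summable_mono[OF assms]) (auto simp: norm_mult intro!: mult_right_mono)
  from moment_summable_0[OF this] have "(\<lambda>m. norm (\<omega> m) * cmod (a m)) summable_on UNIV"
    by (simp add: norm_mult)
  note D = expsum_has_partial[OF moment_summable_0[OF assms] this]
  show "partial s (expsum \<omega> a) = expsum \<omega> (\<lambda>m. \<i> * of_real (\<omega> m $ s) * a m)"
    unfolding partial_def by (rule ext, rule vector_derivative_at, rule D)
  show "(\<lambda>h::real. expsum \<omega> a (x + h *\<^sub>R axis s 1)) differentiable (at 0)"
    using D unfolding has_vector_derivative_def by (rule differentiableI)
qed

lemma C_class_expsum: "moment_summable r a \<Longrightarrow> C_class r (expsum \<omega> a)"
proof (induction r arbitrary: a)
  case 0
  then show ?case by (simp add: continuous_on_expsum moment_summable_0)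
next
  case (Suc r)
  then show ?case
    by (simp add: continuous_on_expsum[OF moment_summable_0] expsum_partial moment_summable_frequency)
qed

lemma partial_funpow_expsum:
  "moment_summable r a \<Longrightarrow>
    (partial s ^^ r) (expsum \<omega> a) = expsum \<omega> (\<lambda>m. (\<i> * of_real (\<omega> m $ s)) ^ r * a m)"
proof (induction r arbitrary: a)
  case (Suc r)
  have "(partial s ^^ Suc r) (expsum \<omega> a) = (partial s ^^ r) (partial s (expsum \<omega> a))"
    by (simp add: funpow_swap1)
  also have "\<dots> = expsum \<omega> (\<lambda>m. (\<i> * of_real (\<omega> m $ s)) ^ r * (\<i> * of_real (\<omega> m $ s) * a m))"
    by (simp only: expsum_partial(1)[OF Suc.prems] Suc.IH[OF moment_summable_frequency[OF Suc.prems]])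
  finally show ?case by (simp add: mult_ac)
qed simp

lemma has_sum_sum:
  fixes f :: "'a \<Rightarrow> 'b \<Rightarrow> 'c::topological_comm_monoid_add"
  assumes "\<And>s. s \<in> A \<Longrightarrow> (f s has_sum S s) B"
  shows "((\<lambda>m. \<Sum>s\<in>A. f s m) has_sum (\<Sum>s\<in>A. S s)) B"
  using assms by (induction A rule: infinite_finite_induct) (simp_all add: has_sum_add)

lemma neg_laplacian_expsum:
  assumes "moment_summable (Suc (Suc r)) a"
  shows "neg_laplacian (expsum \<omega> a) = expsum \<omega> (\<lambda>m. of_real ((norm (\<omega> m))\<^sup>2) * a m)"
    and "moment_summable r (\<lambda>m. of_real ((norm (\<omega> m))\<^sup>2) * a m)"
proof
  note m1 = moment_summable_frequency[OF assms]
  note m2 = moment_summable_frequency[OF m1]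
  fix x
  have "neg_laplacian (expsum \<omega> a) x
      = - (\<Sum>s\<in>UNIV. expsum \<omega> (\<lambda>m. \<i> * of_real (\<omega> m $ s) * (\<i> * of_real (\<omega> m $ s) * a m)) x)"
    unfolding neg_laplacian_def expsum_partial(1)[OF assms] expsum_partial(1)[OF m1] ..
  also have "\<dots> = - (\<Sum>\<^sub>\<infinity>m. \<Sum>s\<in>UNIV. \<i> * of_real (\<omega> m $ s) * (\<i> * of_real (\<omega> m $ s) * a m) * cis (\<omega> m \<bullet> x))"
    unfolding expsum_def
    by (intro arg_cong[of _ _ uminus] infsumI[symmetric] has_sum_sum has_sum_infsum
        expsum_term_summable moment_summable_0[OF m2])
  also have "\<dots> = expsum \<omega> (\<lambda>m. of_real ((norm (\<omega> m))\<^sup>2) * a m) x"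
    unfolding expsum_def infsum_uminus[symmetric]
  proof (rule infsum_cong)
    fix m
    have "(norm (\<omega> m))\<^sup>2 = (\<Sum>s\<in>UNIV. (\<omega> m $ s)\<^sup>2)"
      by (simp add: norm_vec_def L2_set_def sum_nonneg)
    then show "- (\<Sum>s\<in>UNIV. \<i> * of_real (\<omega> m $ s) * (\<i> * of_real (\<omega> m $ s) * a m) * cis (\<omega> m \<bullet> x))
        = of_real ((norm (\<omega> m))\<^sup>2) * a m * cis (\<omega> m \<bullet> x)"
      by (simp add: sum_distrib_left sum_distrib_right power2_eq_square sum_negf[symmetric] mult_ac)
  qed
  finally show "neg_laplacian (expsum \<omega> a) x = expsum \<omega> (\<lambda>m. of_real ((norm (\<omega> m))\<^sup>2) * a m) x" .
next
  show "moment_summable r (\<lambda>m. of_real ((norm (\<omega> m))\<^sup>2) * a m)"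
  proof (rule moment_summable_mono[OF assms])
    have "(norm (\<omega> m))\<^sup>2 \<le> (1 + norm (\<omega> m))\<^sup>2" for m by (rule power_mono) auto
    then show "cmod (of_real ((norm (\<omega> m))\<^sup>2) * a m) \<le> (1 + norm (\<omega> m)) ^ (Suc (Suc r) - r) * cmod (a m)" for m
      by (simp add: norm_mult mult_right_mono Suc_diff_le numeral_2_eq_2 norm_power)
  qed simp
qed

lemma neg_laplacian_funpow_expsum:
  "moment_summable (2 * l) a \<Longrightarrow>
    (neg_laplacian ^^ l) (expsum \<omega> a) = expsum \<omega> (\<lambda>m. of_real (norm (\<omega> m) ^ (2 * l)) * a m)"
proof (induction l arbitrary: a)
  case (Suc l)
  then have m: "moment_summable (Suc (Suc (2 * l))) a" by simp
  have "(neg_laplacian ^^ Suc l) (expsum \<omega> a) = (neg_laplacian ^^ l) (neg_laplacian (expsum \<omega> a))"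
    by (simp add: funpow_swap1)
  also have "\<dots> = expsum \<omega> (\<lambda>m. of_real (norm (\<omega> m) ^ (2 * l)) * (of_real ((norm (\<omega> m))\<^sup>2) * a m))"
    by (simp only: neg_laplacian_expsum(1)[OF m] Suc.IH[OF neg_laplacian_expsum(2)[OF m]])
  finally show ?case by (simp add: power2_eq_square mult_ac)
qed simp

end

text \<open>All frequencies differ from \<open>t\<close> by integer vectors, so a translation by one
  period multiplies every term of the series, and of its derivatives, by the same factor.\<close>

lemma quasi_periodic_expsum:
  assumes "moment_summable (\<lambda>m. Pvec (j + m) t) (2 * l) a"
  shows "quasi_periodic l t (expsum (\<lambda>m. Pvec (j + m) t) a)"
  unfolding quasi_periodic_def
proof (intro allI impI)
  fix s and r :: nat and x
  assume "r < 2 * l"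
  let ?\<omega> = "\<lambda>m. Pvec (j + m) t"
  have m: "moment_summable ?\<omega> r a"
    using \<open>r < 2 * l\<close> by (intro moment_summable_mono[OF assms]) (auto simp: mult_le_cancel_right1)
  have shift: "cis (?\<omega> m \<bullet> (x + (2 * pi) *\<^sub>R axis s 1)) = cis (2 * pi * t $ s) * cis (?\<omega> m \<bullet> x)" for m
  proof -
    have "cis (2 * pi * of_int (j $ s + m $ s)) = 1" by (rule cis_multiple_2pi) simp
    then have "cis (2 * pi * (of_int (j $ s + m $ s) + t $ s)) = cis (2 * pi * t $ s)"
      by (simp add: distrib_left cis_mult[symmetric] del: of_int_add)
    moreover have "?\<omega> m \<bullet> (x + (2 * pi) *\<^sub>R axis s 1) = 2 * pi * (of_int (j $ s + m $ s) + t $ s) + ?\<omega> m \<bullet> x"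
      by (simp add: inner_add_right inner_axis Pvec_def rvec_def)
    ultimately show ?thesis by (simp add: cis_mult[symmetric])
  qed
  show "(partial s ^^ r) (expsum ?\<omega> a) (x + (2 * pi) *\<^sub>R axis s 1)
      = cis (2 * pi * t $ s) * (partial s ^^ r) (expsum ?\<omega> a) x"
    unfolding partial_funpow_expsum[OF m] expsum_def shift
    by (simp add: mult.left_commute[of _ "cis (2 * pi * t $ s)"] infsum_cmult_right')
qed


section \<open>Lyapunov--Schmidt reduction\<close>

text \<open>
  Here \<open>P\<close> projects off the resonant block, \<open>R\<close> is the resolvent there, \<open>E\<close> embeds multiples of the second
  eigenvector, and \<open>\<Phi>\<close>, \<open>\<Psi>\<close> are the coordinates along the two eigenvectors. The block component is computed
  from the already updated off-block component \<open>R (r h)\<close>: in terms of the old one its Lipschitz constant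
  would be of order \<open>b / \<omega>\<^sub>0\<close>, which is not small.
\<close>

lemma reduced_fixed_point:
  fixes V R P N :: "'a::banach \<Rightarrow> 'a" and E :: "complex \<Rightarrow> 'a" and \<Phi> \<Psi> :: "'a \<Rightarrow> complex"
    and \<kappa> \<omega> \<omega>\<^sub>0 \<tau> b :: real and f :: 'a
  defines "\<theta> \<equiv> b * (4 * b + 81) * \<tau> + 27 * \<bar>\<kappa>\<bar>"
  defines "K \<equiv> (4 * b + 81) * \<tau> + 6 * \<theta> / \<omega>\<^sub>0"
  assumes lin: "linear V" "linear R" "linear P" "linear E" "linear \<Phi>" "linear \<Psi>"
    and nV: "\<And>x. norm (V x) \<le> b * norm x" and nR: "\<And>x. norm (R x) \<le> \<tau> * norm x"
    and nP: "\<And>x. norm (P x) \<le> norm x" and nE: "\<And>c. norm (E c) \<le> 2 * cmod c"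
    and n\<Phi>: "\<And>x. cmod (\<Phi> x) \<le> norm x" and n\<Psi>: "\<And>x. cmod (\<Psi> x) \<le> norm x"
    and nf: "norm f \<le> 2"
    and nN: "\<And>h. norm h \<le> 1 \<Longrightarrow> norm (N (f + h)) \<le> 27"
    and lN: "\<And>h h'. norm h \<le> 1 \<Longrightarrow> norm h' \<le> 1 \<Longrightarrow> norm (N (f + h) - N (f + h')) \<le> 27 * norm (h - h')"
    and PR: "\<And>x. P (R x) = R x" and PE: "\<And>c. P (E c) = 0"
    and \<Psi>R: "\<And>x. \<Psi> (R x) = 0" and \<Psi>E: "\<And>c. \<Psi> (E c) = c"
    and b: "b \<ge> 0" and \<tau>: "\<tau> \<ge> 0" and \<kappa>: "\<bar>\<kappa>\<bar> \<le> 1" and \<omega>: "\<omega>\<^sub>0 > 0" "\<bar>\<omega>\<bar> \<ge> \<omega>\<^sub>0"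
    and K: "K \<le> 1 / 2"
  shows "\<exists>y c \<mu>. norm (y + E c) \<le> K \<and> \<bar>\<mu>\<bar> \<le> \<theta>
    \<and> y = R (\<mu> *\<^sub>R (y + E c) - V (f + (y + E c)) - \<kappa> *\<^sub>R N (f + (y + E c)))
    \<and> \<mu> = Re (\<Phi> (V y + \<kappa> *\<^sub>R N (f + (y + E c))))
    \<and> of_real \<omega> * c = of_real \<mu> * c - \<Psi> (V y + \<kappa> *\<^sub>R N (f + (y + E c)))"
proof -
  \<comment> \<open>The update of the off-block part needs an eigenvalue shift, while the shift is
    to be computed from the updated part. A provisional shift \<open>\<mu>\<^sub>0\<close>, taken
    from the old \<open>P h\<close>, breaks the circle; at a fixed point it agrees with
    \<open>\<mu>\<close>.\<close>
  define \<mu>\<^sub>0 where "\<mu>\<^sub>0 h = Re (\<Phi> (V (P h) + \<kappa> *\<^sub>R N (f + h)))" for h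
  define r where "r h = \<mu>\<^sub>0 h *\<^sub>R h - V (f + h) - \<kappa> *\<^sub>R N (f + h)" for h
  define z where "z h = V (R (r h)) + \<kappa> *\<^sub>R N (f + h)" for h
  define \<mu> where "\<mu> h = Re (\<Phi> (z h))" for h
  \<comment> \<open>The last equation of the claim solved for the coefficient, with the old
    coefficient \<open>\<Psi> h\<close> on the right-hand side.\<close>
  define c where "c h = (of_real (\<mu> h) * \<Psi> h - \<Psi> (z h)) / of_real \<omega>" for h
  define T where "T h = R (r h) + E (c h)" for h
  note diffs = lin[THEN linear_diff]
  have \<theta>0: "\<theta> \<ge> 0" unfolding \<theta>_def using b \<tau> by simp
  have \<omega>': "x / \<bar>\<omega>\<bar> \<le> x / \<omega>\<^sub>0" if "x \<ge> 0" for x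
    using \<omega> that by (simp add: frac_le)
  \<comment> \<open>Two versions: the first keeps the small factor for the estimates by \<theta>,
    the second drops it where boundedness is enough because the resolvent supplies the
    smallness.\<close>
  have \<kappa>N: "norm (\<kappa> *\<^sub>R N (f + h)) \<le> 27 * \<bar>\<kappa>\<bar>" "norm (\<kappa> *\<^sub>R N (f + h)) \<le> 27" if "norm h \<le> 1" for h
    using mult_mono[OF order_refl nN[OF that], of "\<bar>\<kappa>\<bar>"] mult_mono[OF \<kappa> nN[OF that]] by simp_all
  have \<kappa>lN: "norm (\<kappa> *\<^sub>R N (f + h) - \<kappa> *\<^sub>R N (f + h')) \<le> 27 * \<bar>\<kappa>\<bar> * norm (h - h')"
    "norm (\<kappa> *\<^sub>R N (f + h) - \<kappa> *\<^sub>R N (f + h')) \<le> 27 * norm (h - h')"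
    if "norm h \<le> 1" "norm h' \<le> 1" for h h'
    using mult_mono[OF order_refl lN[OF that], of "\<bar>\<kappa>\<bar>"] mult_mono[OF \<kappa> lN[OF that]]
    by (simp_all flip: scaleR_diff_right)
  have \<mu>0: "\<bar>\<mu>\<^sub>0 h\<bar> \<le> b + 27" if h: "norm h \<le> 1" for h
  proof -
    have "\<bar>\<mu>\<^sub>0 h\<bar> \<le> norm (V (P h) + \<kappa> *\<^sub>R N (f + h))"
      unfolding \<mu>\<^sub>0_def by (rule order_trans[OF abs_Re_le_cmod n\<Phi>])
    moreover have "norm (V (P h)) \<le> b"
      using order_trans[OF nV mult_left_mono[OF order_trans[OF nP h] b]] by simp
    ultimately show ?thesis
      using \<kappa>N(2)[OF h] norm_triangle_ineq[of "V (P h)" "\<kappa> *\<^sub>R N (f + h)"] by linarith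
  qed
  have \<mu>0l: "\<bar>\<mu>\<^sub>0 h - \<mu>\<^sub>0 h'\<bar> \<le> (b + 27) * norm (h - h')" if h: "norm h \<le> 1" "norm h' \<le> 1" for h h'
  proof -
    have "\<mu>\<^sub>0 h - \<mu>\<^sub>0 h' = Re (\<Phi> (V (P (h - h')) + (\<kappa> *\<^sub>R N (f + h) - \<kappa> *\<^sub>R N (f + h'))))"
      unfolding \<mu>\<^sub>0_def minus_complex.sel(1)[symmetric] diffs(5)[symmetric]
      by (simp add: diffs algebra_simps)
    then have "\<bar>\<mu>\<^sub>0 h - \<mu>\<^sub>0 h'\<bar> \<le> norm (V (P (h - h')) + (\<kappa> *\<^sub>R N (f + h) - \<kappa> *\<^sub>R N (f + h')))"
      by (simp only:) (rule order_trans[OF abs_Re_le_cmod n\<Phi>])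
    moreover have "norm (V (P (h - h'))) \<le> b * norm (h - h')"
      by (rule order_trans[OF nV mult_left_mono[OF nP b]])
    ultimately show ?thesis
      using \<kappa>lN(2)[OF h] norm_triangle_ineq[of "V (P (h - h'))" "\<kappa> *\<^sub>R N (f + h) - \<kappa> *\<^sub>R N (f + h')"]
      by (simp add: distrib_right)
  qed
  \<comment> \<open>The constant \<open>4 * b + 81\<close> is a common majorant: the size of
    \<open>r h\<close> comes out as at most \<open>4 * b + 54\<close>, its Lipschitz constant below
    as at most \<open>3 * b + 81\<close>.\<close>
  have r: "norm (r h) \<le> 4 * b + 81" if h: "norm h \<le> 1" for h
  proof -
    have "norm (\<mu>\<^sub>0 h *\<^sub>R h) \<le> b + 27"
      using mult_mono[OF \<mu>0[OF h] h] b by simp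
    moreover have "norm (V (f + h)) \<le> b * 3"
      by (rule order_trans[OF nV mult_left_mono[OF _ b]])
         (use norm_triangle_ineq[of f h] nf h in linarith)
    moreover have "norm (A - B - C) \<le> norm A + norm B + norm C" for A B C :: 'a by norm
    then have "norm (r h) \<le> norm (\<mu>\<^sub>0 h *\<^sub>R h) + norm (V (f + h)) + norm (\<kappa> *\<^sub>R N (f + h))"
      unfolding r_def .
    ultimately show ?thesis using \<kappa>N(2)[OF h] by linarith
  qed
  have rl: "norm (r h - r h') \<le> (4 * b + 81) * norm (h - h')" if h: "norm h \<le> 1" "norm h' \<le> 1" for h h'
  proof -
    let ?d = "norm (h - h')"
    have "V (f + h) - V (f + h') = V (h - h')" by (simp flip: diffs(1))
    then have "r h - r h' = \<mu>\<^sub>0 h *\<^sub>R (h - h') + (\<mu>\<^sub>0 h - \<mu>\<^sub>0 h') *\<^sub>R h' - V (h - h')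
        - (\<kappa> *\<^sub>R N (f + h) - \<kappa> *\<^sub>R N (f + h'))"
      by (simp add: r_def algebra_simps)
    moreover have "norm (A + B - C - D) \<le> norm A + norm B + norm C + norm D" for A B C D :: 'a by norm
    ultimately have "norm (r h - r h') \<le> norm (\<mu>\<^sub>0 h *\<^sub>R (h - h')) + norm ((\<mu>\<^sub>0 h - \<mu>\<^sub>0 h') *\<^sub>R h')
        + norm (V (h - h')) + norm (\<kappa> *\<^sub>R N (f + h) - \<kappa> *\<^sub>R N (f + h'))"
      by (simp only:)
    moreover have "norm (\<mu>\<^sub>0 h *\<^sub>R (h - h')) \<le> (b + 27) * ?d"
      using mult_right_mono[OF \<mu>0[OF h(1)], of ?d] by simp
    moreover have "norm ((\<mu>\<^sub>0 h - \<mu>\<^sub>0 h') *\<^sub>R h') \<le> (b + 27) * ?d"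
      using mult_mono[OF \<mu>0l[OF h] h(2)] b by simp
    ultimately have "norm (r h - r h') \<le> (b + 27) * ?d + (b + 27) * ?d + b * ?d + 27 * ?d"
      using \<kappa>lN(2)[OF h] nV[of "h - h'"] by linarith
    also have "\<dots> \<le> (4 * b + 81) * ?d"
      using mult_nonneg_nonneg[OF b norm_ge_zero[of "h - h'"]] by (simp add: algebra_simps)
    finally show ?thesis .
  qed
  have Rr: "norm (R (r h)) \<le> (4 * b + 81) * \<tau>" if "norm h \<le> 1" for h
    using order_trans[OF nR mult_left_mono[OF r[OF that] \<tau>]] by (simp add: mult_ac)
  have Rrl: "norm (R (r h) - R (r h')) \<le> (4 * b + 81) * \<tau> * norm (h - h')"
    if "norm h \<le> 1" "norm h' \<le> 1" for h h'
    unfolding diffs(2)[symmetric]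
    using order_trans[OF nR mult_left_mono[OF rl[OF that] \<tau>]] by (simp add: mult_ac)
  \<comment> \<open>The number \<theta> is both a bound and a Lipschitz constant for
    \<open>z\<close>: the potential after the resolvent gives its first summand, the cubic term its
    second.\<close>
  have z: "norm (z h) \<le> \<theta>" if h: "norm h \<le> 1" for h
    using norm_triangle_ineq[of "V (R (r h))" "\<kappa> *\<^sub>R N (f + h)"] \<kappa>N(1)[OF h]
      order_trans[OF nV mult_left_mono[OF Rr[OF h] b]]
    unfolding z_def \<theta>_def by (simp add: mult_ac)
  have zl: "norm (z h - z h') \<le> \<theta> * norm (h - h')" if h: "norm h \<le> 1" "norm h' \<le> 1" for h h'
  proof -
    have "z h - z h' = V (R (r h) - R (r h')) + (\<kappa> *\<^sub>R N (f + h) - \<kappa> *\<^sub>R N (f + h'))"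
      by (simp add: z_def diffs)
    then have "norm (z h - z h') \<le> norm (V (R (r h) - R (r h'))) + norm (\<kappa> *\<^sub>R N (f + h) - \<kappa> *\<^sub>R N (f + h'))"
      by (simp only: norm_triangle_ineq)
    also have "\<dots> \<le> b * ((4 * b + 81) * \<tau> * norm (h - h')) + 27 * \<bar>\<kappa>\<bar> * norm (h - h')"
      by (intro add_mono order_trans[OF nV mult_left_mono[OF Rrl[OF h] b]] \<kappa>lN h)
    finally show ?thesis unfolding \<theta>_def by (simp add: algebra_simps)
  qed
  have \<mu>: "\<bar>\<mu> h\<bar> \<le> \<theta>" if "norm h \<le> 1" for h
    unfolding \<mu>_def using abs_Re_le_cmod[of "\<Phi> (z h)"] n\<Phi>[of "z h"] z[OF that] by linarith
  have \<mu>l: "\<bar>\<mu> h - \<mu> h'\<bar> \<le> \<theta> * norm (h - h')" if "norm h \<le> 1" "norm h' \<le> 1" for h h'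
    using abs_Re_le_cmod[of "\<Phi> (z h - z h')"] n\<Phi>[of "z h - z h'"] zl[OF that]
    unfolding \<mu>_def diffs(5) by simp
  have c: "cmod (c h) \<le> 2 * \<theta> / \<omega>\<^sub>0" if h: "norm h \<le> 1" for h
  proof -
    have "cmod (of_real (\<mu> h) * \<Psi> h) \<le> \<theta> * 1"
      unfolding norm_mult norm_of_real
      by (intro mult_mono \<mu> h order_trans[OF n\<Psi> h] \<theta>0) simp
    then have "cmod (of_real (\<mu> h) * \<Psi> h - \<Psi> (z h)) \<le> 2 * \<theta>"
      using norm_triangle_ineq4[of "of_real (\<mu> h) * \<Psi> h" "\<Psi> (z h)"] n\<Psi>[of "z h"] z[OF h] by linarith
    then have "cmod (c h) \<le> 2 * \<theta> / \<bar>\<omega>\<bar>"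
      unfolding c_def norm_divide norm_of_real by (rule divide_right_mono) simp
    then show ?thesis using \<omega>'[of "2 * \<theta>"] \<theta>0 by simp
  qed
  have cl: "cmod (c h - c h') \<le> 3 * \<theta> / \<omega>\<^sub>0 * norm (h - h')" if h: "norm h \<le> 1" "norm h' \<le> 1" for h h'
  proof -
    let ?d = "norm (h - h')"
    have eq: "c h - c h' = (of_real (\<mu> h) * \<Psi> (h - h') + of_real (\<mu> h - \<mu> h') * \<Psi> h' - \<Psi> (z h - z h')) / of_real \<omega>"
      unfolding c_def by (simp add: diffs algebra_simps diff_divide_distrib add_divide_distrib)
    let ?A = "of_real (\<mu> h) * \<Psi> (h - h')" and ?B = "of_real (\<mu> h - \<mu> h') * \<Psi> h'" and ?C = "\<Psi> (z h - z h')"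
    have "cmod ?A \<le> \<theta> * ?d"
      unfolding norm_mult norm_of_real by (intro mult_mono \<mu> h n\<Psi> \<theta>0) simp
    moreover have "cmod ?B \<le> \<theta> * ?d * 1"
      unfolding norm_mult norm_of_real
      by (intro mult_mono \<mu>l h order_trans[OF n\<Psi> h(2)] mult_nonneg_nonneg \<theta>0) simp_all
    moreover have "cmod ?C \<le> \<theta> * ?d"
      by (rule order_trans[OF n\<Psi> zl[OF h]])
    moreover have "cmod (?A + ?B - ?C) \<le> cmod ?A + cmod ?B + cmod ?C"
      by (rule order_trans[OF norm_triangle_ineq4 add_right_mono[OF norm_triangle_ineq]])
    ultimately have "cmod (?A + ?B - ?C) \<le> 3 * \<theta> * ?d"
      by linarith
    then have "cmod (c h - c h') \<le> 3 * \<theta> * ?d / \<bar>\<omega>\<bar>"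
      unfolding eq norm_divide norm_of_real by (rule divide_right_mono) simp
    then show ?thesis using \<omega>'[of "3 * \<theta> * ?d"] \<theta>0 by simp
  qed
  \<comment> \<open>\<open>K\<close> likewise does double duty. The size needs only
    \<open>4 * \<theta> / \<omega>\<^sub>0\<close>; the 6 comes from the Lipschitz constant
    \<open>3 * \<theta> / \<omega>\<^sub>0\<close> of \<open>c\<close> and the factor 2 of
    \<open>E\<close>. So \<open>K \<le> 1 / 2\<close> yields a contraction of the unit ball whose
    fixed point has norm at most \<open>K\<close>.\<close>
  have T: "norm (T h) \<le> K" if h: "norm h \<le> 1" for h
  proof -
    have "norm (E (c h)) \<le> 4 * \<theta> / \<omega>\<^sub>0" using nE[of "c h"] c[OF h] by simp
    moreover have "4 * \<theta> / \<omega>\<^sub>0 \<le> 6 * \<theta> / \<omega>\<^sub>0" using \<theta>0 \<omega> by (simp add: divide_right_mono)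
    ultimately show ?thesis
      unfolding T_def K_def using norm_triangle_ineq[of "R (r h)" "E (c h)"] Rr[OF h] by linarith
  qed
  have Tl: "norm (T h - T h') \<le> K * norm (h - h')" if h: "norm h \<le> 1" "norm h' \<le> 1" for h h'
  proof -
    have "T h - T h' = (R (r h) - R (r h')) + E (c h - c h')" by (simp add: T_def diffs)
    then have "norm (T h - T h') \<le> norm (R (r h) - R (r h')) + norm (E (c h - c h'))"
      by (simp only: norm_triangle_ineq)
    also have "\<dots> \<le> (4 * b + 81) * \<tau> * norm (h - h') + 2 * (3 * \<theta> / \<omega>\<^sub>0 * norm (h - h'))"
      by (intro add_mono Rrl h order_trans[OF nE]) (use cl[OF h] in simp)
    finally show ?thesis unfolding K_def by (simp add: algebra_simps)
  qed
  have K0: "K \<ge> 0" using order_trans[OF norm_ge_zero T[of 0]] by simp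
  have "\<exists>!h\<in>cball 0 1. T h = h"
  proof (rule Banach_fix[of _ K])
    show "complete (cball (0 :: 'a) 1)" by (simp add: complete_eq_closed)
    show "T ` cball 0 1 \<subseteq> cball 0 1" using T K by fastforce
    show "dist (T h) (T h') \<le> K * dist h h'" if "h \<in> cball 0 1" "h' \<in> cball 0 1" for h h'
      using Tl that by (simp add: dist_norm)
  qed (use K K0 in auto)
  then obtain h where h: "norm h \<le> 1" "R (r h) + E (c h) = h"
    unfolding T_def mem_cball_0 by blast
  \<comment> \<open>Applying \<open>P\<close> and \<Psi> to the fixed point separates its two parts:
    the old and the updated quantities coincide, which turns the iteration scheme into the equations
    claimed.\<close>
  have Ph: "P h = R (r h)" by (subst h(2)[symmetric]) (simp add: linear_add[OF lin(3)] PR PE)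
  have \<Psi>h: "\<Psi> h = c h" by (subst h(2)[symmetric]) (simp add: linear_add[OF lin(6)] \<Psi>R \<Psi>E)
  have \<mu>h: "\<mu>\<^sub>0 h = \<mu> h" by (simp add: \<mu>\<^sub>0_def \<mu>_def z_def Ph)
  have "\<omega> \<noteq> 0" using \<omega> by auto
  then have c': "of_real \<omega> * c h = of_real (\<mu> h) * c h - \<Psi> (z h)"
    by (subst c_def) (simp only: \<Psi>h, simp)
  have Th: "norm (R (r h) + E (c h)) \<le> K" using T[OF h(1)] by (simp only: T_def)
  show ?thesis
  proof (intro exI conjI)
    show "norm (R (r h) + E (c h)) \<le> K" "\<bar>\<mu> h\<bar> \<le> \<theta>"
      by (rule Th, rule \<mu>[OF h(1)])
    show "R (r h) = R (\<mu> h *\<^sub>R (R (r h) + E (c h)) - V (f + (R (r h) + E (c h)))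
        - \<kappa> *\<^sub>R N (f + (R (r h) + E (c h))))"
      unfolding h(2) by (simp only: r_def \<mu>h)
    show "\<mu> h = Re (\<Phi> (V (R (r h)) + \<kappa> *\<^sub>R N (f + (R (r h) + E (c h)))))"
      unfolding h(2) by (simp only: \<mu>_def z_def)
    show "of_real \<omega> * c h = of_real (\<mu> h) * c h
        - \<Psi> (V (R (r h)) + \<kappa> *\<^sub>R N (f + (R (r h) + E (c h))))"
      unfolding h(2) using c' by (simp only: z_def)
  qed
qed


section \<open>The model matrix and the cubic term\<close>

text \<open>Guards against the default value 0 of an infinite \<open>sum\<close> in
  \<open>trig_poly\<close>.\<close>

lemma finite_lattice_ball: "finite {m :: int ^ 'n::finite. norm (rvec m) \<le> R}"
proof -
  let ?S = "{m :: int ^ 'n. norm (rvec m) \<le> R}"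
  have "($) ` ?S \<subseteq> PiE UNIV (\<lambda>_. {- \<lceil>R\<rceil>..\<lceil>R\<rceil>})"
  proof (clarsimp simp: PiE_UNIV_domain)
    fix m :: "int ^ 'n" and s assume "norm (rvec m) \<le> R"
    then have "\<bar>real_of_int (m $ s)\<bar> \<le> R"
      using component_le_norm_cart[of "rvec m" s] by (simp add: rvec_def)
    then show "- \<lceil>R\<rceil> \<le> m $ s \<and> m $ s \<le> \<lceil>R\<rceil>" by linarith
  qed
  then have "finite (($) ` ?S)" by (rule finite_subset) (intro finite_PiE, auto)
  moreover have "inj_on ($) ?S" by (rule inj_onI) (simp add: vec_nth_inject)
  ultimately show ?thesis by (rule finite_imageD)
qed

lemma eval_inject: "(\<And>\<theta>. eval x \<theta> = eval y \<theta>) \<Longrightarrow> x = y"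
  by (rule ell1_eqI) (metis fourier_coeff_eval ext)

lemma
  fixes v :: "int ^ 'n::finite \<Rightarrow> complex"
  assumes supp: "\<And>m. v m \<noteq> 0 \<Longrightarrow> 0 < norm (rvec m) \<and> norm (rvec m) \<le> R"
  shows cf_potential: "cf (Abs_ell1 v) = v"
    and eval_potential: "eval (Abs_ell1 v) \<theta> = trig_poly v R \<theta>"
proof -
  let ?S = "{m :: int ^ 'n. 0 < norm (rvec m) \<and> norm (rvec m) \<le> R}"
  have fin: "finite ?S" by (rule finite_subset[OF _ finite_lattice_ball[of R]]) auto
  have "(\<lambda>m. cmod (v m)) summable_on ?S" by (rule summable_on_finite[OF fin])
  then have "v abs_summable_on UNIV"
    by (rule summable_on_cong_neutral[THEN iffD1, rotated -1]) (use supp in auto)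
  then show c: "cf (Abs_ell1 v) = v" by (rule cf_Abs)
  have "eval (Abs_ell1 v) \<theta> = (\<Sum>\<^sub>\<infinity>m\<in>?S. v m * cis (rvec m \<bullet> \<theta>))"
    unfolding eval_def expsum_def c by (rule infsum_cong_neutral) (use supp in auto)
  then show "eval (Abs_ell1 v) \<theta> = trig_poly v R \<theta>"
    unfolding trig_poly_def infsum_finite[OF fin] .
qed

lemma cf_uminus_of_real_eval:
  fixes x :: "(int ^ 'n::finite) ell1"
  assumes "\<And>\<theta>. eval x \<theta> \<in> \<real>"
  shows "cf x (- m) = cnj (cf x m)"
proof -
  have "star x = x"
    by (rule eval_inject) (use assms in \<open>simp add: eval_star Reals_cnj_iff\<close>)
  then show ?thesis by (metis star.rep_eq complex_cnj_cnj)
qed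

text \<open>Since \<open>v q \<noteq> 0\<close>, the eigenspace is a line and column
  \<open>j\<close> of the projection is a multiple of any unit eigenvector; the one chosen has a
  real second entry. Then \<open>(- f1, cnj f0)\<close> completes it to an orthonormal basis and
  belongs to the other eigenvalue, which by the trace is \<open>a + c - \<nu>\<close>.\<close>

lemma E_hat_column:
  fixes v :: "int ^ 'n::finite \<Rightarrow> complex" and l :: nat and j q :: "int ^ 'n" and t :: "real ^ 'n" and \<epsilon> :: real
  assumes herm: "v (- q) = cnj (v q)" and vq: "v q \<noteq> 0" and q: "q \<noteq> 0" and \<epsilon>: "\<epsilon> \<in> {1, -1}"
  defines "a \<equiv> pnorm j t ^ (2 * l)" and "c \<equiv> pnorm (j - q) t ^ (2 * l)"
  defines "\<nu> \<equiv> lam_hat l v q j \<epsilon> t"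
  obtains f0 :: complex and f1 :: real and \<kappa> :: complex
  where "f0 * cnj f0 + of_real f1 * of_real f1 = 1" "cmod \<kappa> \<le> 1"
    "E_hat l v q j \<epsilon> t j j = \<kappa> * f0" "E_hat l v q j \<epsilon> t (j - q) j = \<kappa> * of_real f1"
    "of_real a * f0 + v q * of_real f1 = of_real \<nu> * f0"
    "cnj (v q) * f0 + of_real c * of_real f1 = of_real \<nu> * of_real f1"
    "of_real a * - of_real f1 + v q * cnj f0 = of_real (a + c - \<nu>) * - of_real f1"
    "cnj (v q) * - of_real f1 + of_real c * cnj f0 = of_real (a + c - \<nu>) * cnj f0"
    "\<bar>a + c - \<nu> - \<nu>\<bar> \<ge> 2 * cmod (v q)"
proof -
  define w where "w = v q"
  define M where "M = model_matrix l v q j t"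
  define r where "r = sqrt (4 * (cmod w)\<^sup>2 + (a - c)\<^sup>2)"
  have w: "w \<noteq> 0" using vq by (simp add: w_def)
  have M: "M = vector [vector [of_real a, w], vector [cnj w, of_real c]]"
    by (simp add: M_def model_matrix_def a_def c_def w_def herm)
  have \<nu>_eq: "\<nu> = (a + c) / 2 + \<epsilon> * (r / 2)"
    by (simp add: \<nu>_def lam_hat_def a_def c_def w_def r_def)
  obtain E where E: "orth_eigenprojection M (of_real \<nu>) E"
    using orth_eigenprojection_exists[OF \<epsilon> w, of a c] unfolding M \<nu>_eq r_def by blast
  then have THE: "(THE E. orth_eigenprojection M (of_real \<nu>) E) = E"
    by (intro the_equality) (auto intro: orth_eigenprojection_unique)
  have E11: "E_hat l v q j \<epsilon> t j j = E $ 1 $ 1" and E21: "E_hat l v q j \<epsilon> t (j - q) j = E $ 2 $ 1"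
    using THE q by (simp_all add: E_hat_def M_def \<nu>_def)
  \<comment> \<open>The vector \<open>(w, D)\<close> satisfies the first row of the eigenvalue
    equation identically, and \<open>w \<noteq> 0\<close> keeps it from vanishing for either
    sign.\<close>
  define D where "D = \<nu> - a"
  define N where "N = sqrt ((cmod w)\<^sup>2 + D\<^sup>2)"
  have N: "N > 0" using w by (simp add: N_def add_pos_nonneg)
  have N2: "N * N = (cmod w)\<^sup>2 + D\<^sup>2" by (simp add: N_def)
  have r2: "r * r = 4 * (cmod w)\<^sup>2 + (a - c)\<^sup>2" by (simp add: r_def)
  have e2: "\<epsilon> * \<epsilon> = 1" using \<epsilon> by auto
  have "D * (\<nu> - c) = (\<epsilon> * \<epsilon> * (r * r) - (a - c)\<^sup>2) / 4"
    by (simp add: D_def \<nu>_eq) (simp add: field_simps power2_eq_square)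
  then have quad: "D * (\<nu> - c) = (cmod w)\<^sup>2" by (simp add: e2 r2)
  have quadc: "of_real D * (of_real \<nu> - of_real c) = w * cnj w"
    by (metis quad complex_norm_square of_real_diff of_real_mult)
  have Dc: "of_real \<nu> = of_real D + of_real a" by (simp add: D_def)
  define f0 where "f0 = w / of_real N"
  define f1 where "f1 = D / N"
  define \<kappa> where "\<kappa> = E $ 1 $ 1 * of_real N / w"
  have Nc: "complex_of_real N * of_real N = w * cnj w + of_real D * of_real D"
    by (metis N2 complex_norm_square of_real_add of_real_mult power2_eq_square)
  have unit: "f0 * cnj f0 + of_real f1 * of_real f1 = 1"
  proof -
    have "f0 * cnj f0 + of_real f1 * of_real f1 = (w * cnj w + of_real D * of_real D) / (of_real N * of_real N)"
      by (simp add: f0_def f1_def add_divide_distrib)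
    also have "\<dots> = of_real N * of_real N / (of_real N * of_real N)"
      by (simp only: Nc)
    finally show ?thesis using N by simp
  qed
  have "E *v axis 1 1 \<in> {x. M *v x = of_real \<nu> *s x}"
    using E unfolding orth_eigenprojection_def by blast
  then have "of_real a * E $ 1 $ 1 + w * E $ 2 $ 1 = of_real \<nu> * E $ 1 $ 1"
    by (simp add: vec_eq_iff forall_2 M matrix_vector_mult_def sum_2 axis_def)
  then have row: "w * E $ 2 $ 1 = of_real D * E $ 1 $ 1"
    unfolding Dc by (simp add: algebra_simps)
  have \<kappa>0: "E $ 1 $ 1 = \<kappa> * f0" using w N by (simp add: \<kappa>_def f0_def)
  have \<kappa>1: "E $ 2 $ 1 = \<kappa> * of_real f1"
  proof -
    have "\<kappa> * of_real f1 = of_real D * E $ 1 $ 1 / w" using N by (simp add: \<kappa>_def f1_def)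
    then show ?thesis using w by (simp flip: row)
  qed
  \<comment> \<open>A diagonal entry of a Hermitian idempotent is the squared norm of its column.
    Hence \<open>\<kappa> * f0\<close> is the squared modulus of \<kappa>, and the modulus of
    \<kappa> is at most that of \<open>f0\<close>.\<close>
  have sq: "(cmod \<kappa>)\<^sup>2 = cmod (\<kappa> * f0)"
  proof -
    have "E ** E = E" using E unfolding orth_eigenprojection_def by blast
    then have "E $ 1 $ 1 = (E ** E) $ 1 $ 1" by simp
    also have "\<dots> = E $ 1 $ 1 * E $ 1 $ 1 + E $ 1 $ 2 * E $ 2 $ 1"
      by (simp add: matrix_matrix_mult_def sum_2)
    also have "\<dots> = E $ 1 $ 1 * cnj (E $ 1 $ 1) + E $ 2 $ 1 * cnj (E $ 2 $ 1)"
    proof -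
      have "E $ 1 $ 1 = cnj (E $ 1 $ 1)" "E $ 1 $ 2 = cnj (E $ 2 $ 1)"
        using E unfolding orth_eigenprojection_def by blast+
      then show ?thesis by (metis mult.commute)
    qed
    also have "\<dots> = \<kappa> * cnj \<kappa> * (f0 * cnj f0 + of_real f1 * of_real f1)"
      unfolding \<kappa>0 \<kappa>1 by (simp add: algebra_simps)
    finally have "\<kappa> * f0 = \<kappa> * cnj \<kappa>" by (simp add: unit \<kappa>0)
    then show ?thesis by (auto simp: norm_mult power2_eq_square)
  qed
  have "(cmod f0)\<^sup>2 + f1\<^sup>2 = 1"
    using unit by (metis complex_norm_square of_real_1 of_real_add of_real_eq_iff of_real_mult power2_eq_square)
  then have "(cmod f0)\<^sup>2 \<le> 1\<^sup>2" by (smt (verit) zero_le_power2 one_power2)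
  then have f0: "cmod f0 \<le> 1" by (rule power2_le_imp_le) simp
  have \<kappa>: "cmod \<kappa> \<le> 1"
    using sq f0 by (cases "\<kappa> = 0") (simp_all add: norm_mult power2_eq_square)
  have cq: "cnj w * w = of_real D * (of_real D + of_real a - of_real c)"
    using quadc unfolding Dc by (simp add: mult.commute)
  have gap: "\<bar>a + c - \<nu> - \<nu>\<bar> \<ge> 2 * cmod (v q)"
  proof -
    have "2 * cmod w \<le> r"
      unfolding r_def by (rule real_le_rsqrt) (simp add: power_mult_distrib)
    moreover have "\<bar>a + c - \<nu> - \<nu>\<bar> = r"
      using \<epsilon> unfolding \<nu>_eq by (auto simp: r_def)
    ultimately show ?thesis by (simp add: w_def)
  qed
  show thesis
  proof (rule that[OF unit \<kappa> E11[unfolded \<kappa>0] E21[unfolded \<kappa>1] _ _ _ _ gap], fold w_def)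
    have ac: "of_real (a + c - \<nu>) = complex_of_real c - of_real D" by (simp add: D_def)
    have rows: "of_real a * w + w * of_real D = (of_real D + of_real a) * w"
      "cnj w * w + of_real c * of_real D = (of_real D + of_real a) * of_real D"
      "of_real a * - of_real D + w * cnj w = (of_real c - of_real D) * - of_real D"
      "cnj w * - of_real D + of_real c * cnj w = (of_real c - of_real D) * cnj w"
      using cq by (simp_all add: algebra_simps)
    show "of_real a * f0 + w * of_real f1 = of_real \<nu> * f0"
      using arg_cong[OF rows(1), of "\<lambda>z. z / of_real N"]
      by (simp add: f0_def f1_def Dc add_divide_distrib)
    show "cnj w * f0 + of_real c * of_real f1 = of_real \<nu> * of_real f1"
      using arg_cong[OF rows(2), of "\<lambda>z. z / of_real N"]
      by (simp add: f0_def f1_def Dc add_divide_distrib)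
    show "of_real a * - of_real f1 + w * cnj f0 = of_real (a + c - \<nu>) * - of_real f1"
      using arg_cong[OF rows(3), of "\<lambda>z. z / of_real N"]
      unfolding ac by (simp add: f0_def f1_def add_divide_distrib diff_divide_distrib)
    show "cnj w * - of_real f1 + of_real c * cnj f0 = of_real (a + c - \<nu>) * cnj f0"
      using arg_cong[OF rows(4), of "\<lambda>z. z / of_real N"]
      unfolding ac by (simp add: f0_def f1_def add_divide_distrib diff_divide_distrib)
  qed
qed

text \<open>The coefficients of \<open>W * cnj W * W\<close> for \<open>W = eval g\<close>.\<close>

definition cubic :: "'a::ab_group_add ell1 \<Rightarrow> 'a ell1" where
  "cubic g = conv (conv g (star g)) g"

interpretation conv: bounded_bilinear "conv :: 'a::ab_group_add ell1 \<Rightarrow> _"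
  by (rule bounded_bilinear_conv)

lemma norm_cubic:
  assumes "norm g \<le> B"
  shows "norm (cubic g) \<le> B ^ 3"
proof -
  have "norm (cubic g) \<le> norm g * norm g * norm g"
    unfolding cubic_def
    using norm_conv[of "conv g (star g)" g] mult_right_mono[OF norm_conv[of g "star g"], of "norm g"]
    by (simp add: norm_star)
  also have "\<dots> \<le> B ^ 3"
    using power_mono[OF assms, of 3] by (simp add: power3_eq_cube)
  finally show ?thesis .
qed

lemma norm_cubic_diff:
  assumes g: "norm g \<le> B" "norm g' \<le> B"
  shows "norm (cubic g - cubic g') \<le> 3 * B\<^sup>2 * norm (g - g')"
proof -
  have conv3: "norm (conv (conv x y) z) \<le> norm x * norm y * norm z" for x y z :: "'a ell1"
    using norm_conv[of "conv x y" z] mult_right_mono[OF norm_conv[of x y], of "norm z"] by simp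
  have B: "B \<ge> 0" using order_trans[OF norm_ge_zero g(1)] .
  let ?d = "norm (g - g')"
  \<comment> \<open>Telescoping: one of the three factors is exchanged at a time.\<close>
  have "cubic g - cubic g' = conv (conv (g - g') (star g)) g + conv (conv g' (star (g - g'))) g
      + conv (conv g' (star g')) (g - g')"
    unfolding cubic_def star_diff by (simp add: conv.diff_left conv.diff_right)
  then have "norm (cubic g - cubic g') \<le> norm (conv (conv (g - g') (star g)) g)
      + norm (conv (conv g' (star (g - g'))) g) + norm (conv (conv g' (star g')) (g - g'))"
    by (simp only:) (rule order_trans[OF norm_triangle_ineq add_right_mono[OF norm_triangle_ineq]])
  also have "\<dots> \<le> ?d * B * B + B * ?d * B + B * B * ?d"
    by (intro add_mono order_trans[OF conv3] mult_mono g)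
       (use g B in \<open>simp_all add: norm_star\<close>)
  finally show ?thesis by (simp add: power2_eq_square mult_ac)
qed


section \<open>Solutions near the model eigenvectors\<close>

text \<open>Indices are relative to \<open>j\<close>, so the resonant block is
  \<open>{0, - q}\<close>; assumptions \<open>f\<close> and \<open>e\<close> say that
  \<open>(f0, f1)\<close> and \<open>(- f1, cnj f0)\<close> are eigenvectors of the block. Off the
  block the equation is solved for \<open>y\<close> by the resolvent, along the first eigenvector it
  gives \<mu>, and along the second it gives \<open>s\<close>, with the difference of the
  eigenvalues as divisor.\<close>

lemma nonlinear_eigenvector_exists:
  fixes x :: "(int ^ 'n::finite) ell1" and q :: "int ^ 'n" and \<Lambda> :: "int ^ 'n \<Rightarrow> real"
    and f0 :: complex and f1 \<nu> \<kappa> \<tau> \<omega>\<^sub>0 :: real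
  defines "a \<equiv> \<Lambda> 0" and "c \<equiv> \<Lambda> (- q)" and "w \<equiv> cf x q" and "b \<equiv> norm x"
  defines "f \<equiv> single 0 f0 + single (- q) (of_real f1)"
  defines "\<theta> \<equiv> b * (4 * b + 81) * \<tau> + 27 * \<bar>\<kappa>\<bar>"
  defines "K \<equiv> (4 * b + 81) * \<tau> + 6 * \<theta> / \<omega>\<^sub>0"
  assumes q: "q \<noteq> 0" and real: "\<And>\<theta>. eval x \<theta> \<in> \<real>" and x0: "cf x 0 = 0"
    and unit: "f0 * cnj f0 + of_real f1 * of_real f1 = 1"
    and f: "of_real a * f0 + w * of_real f1 = of_real \<nu> * f0"
      "cnj w * f0 + of_real c * of_real f1 = of_real \<nu> * of_real f1"
    and e: "of_real a * - of_real f1 + w * cnj f0 = of_real (a + c - \<nu>) * - of_real f1"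
      "cnj w * - of_real f1 + of_real c * cnj f0 = of_real (a + c - \<nu>) * cnj f0"
    and gap: "\<omega>\<^sub>0 > 0" "\<bar>a + c - \<nu> - \<nu>\<bar> \<ge> \<omega>\<^sub>0"
    and off: "\<And>m. m \<noteq> 0 \<Longrightarrow> m \<noteq> - q \<Longrightarrow> 1 \<le> \<tau> * \<bar>\<Lambda> m - \<nu>\<bar>" and \<tau>: "\<tau> \<ge> 0"
    and \<kappa>: "\<bar>\<kappa>\<bar> \<le> 1" and K: "K \<le> 1 / 2"
  obtains h \<mu> where "norm h \<le> K" "\<bar>\<mu>\<bar> \<le> \<theta>"
    "\<And>m. cf ((\<nu> + \<mu>) *\<^sub>R (f + h) - conv x (f + h) - \<kappa> *\<^sub>R cubic (f + h)) m = of_real (\<Lambda> m) * cf (f + h) m"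
proof -
  have w': "cf x (- q) = cnj w" unfolding w_def by (rule cf_uminus_of_real_eval[OF real])
  define R where "R = multiplier (\<lambda>m. if m \<in> {0, - q} then 0 else 1 / of_real (\<Lambda> m - \<nu>))"
  define P where "P = multiplier (\<lambda>m. if m \<in> {0, - q} then 0 else 1)"
  define E where "E s = single 0 (- of_real f1 * s) + single (- q) (cnj f0 * s)" for s
  \<comment> \<open>Hermitian pairings with the two block eigenvectors, whose conjugates are
    \<open>(cnj f0, f1)\<close> and \<open>(- f1, f0)\<close>.\<close>
  define \<Phi> where "\<Phi> y = cnj f0 * cf y 0 + of_real f1 * cf y (- q)" for y :: "(int ^ 'n) ell1"
  define \<Psi> where "\<Psi> y = - of_real f1 * cf y 0 + f0 * cf y (- q)" for y :: "(int ^ 'n) ell1"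
  have sq: "(cmod f0)\<^sup>2 + f1\<^sup>2 = 1"
    using unit by (metis complex_norm_square of_real_1 of_real_add of_real_eq_iff of_real_mult power2_eq_square)
  have le: "(cmod f0)\<^sup>2 \<le> 1\<^sup>2" "\<bar>f1\<bar>\<^sup>2 \<le> 1\<^sup>2"
    unfolding power2_abs one_power2
    using sq zero_le_power2[of f1] zero_le_power2[of "cmod f0"] by linarith+
  have f01: "cmod f0 \<le> 1" "\<bar>f1\<bar> \<le> 1"
    using le[THEN power2_le_imp_le] by simp_all
  have bR: "cmod (if m \<in> {0, - q} then 0 else 1 / of_real (\<Lambda> m - \<nu>)) \<le> \<tau>" for m
  proof (cases "m \<in> {0, - q}")
    case False
    then have "1 \<le> \<tau> * \<bar>\<Lambda> m - \<nu>\<bar>" by (intro off) auto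
    moreover from this have "\<bar>\<Lambda> m - \<nu>\<bar> > 0" by (metis abs_ge_zero less_eq_real_def mult_zero_right not_one_le_zero)
    ultimately have "1 / \<bar>\<Lambda> m - \<nu>\<bar> \<le> \<tau>" by (simp add: divide_le_eq)
    then show ?thesis using False by (simp add: norm_divide flip: of_real_diff)
  qed (use \<tau> in simp)
  have bP: "cmod (if m \<in> {0, - q} then 0 else 1) \<le> 1" for m by simp
  have cfR: "cf (R y) m = (if m \<in> {0, - q} then 0 else 1 / of_real (\<Lambda> m - \<nu>)) * cf y m" for y m
    unfolding R_def by (rule cf_multiplier[OF bR])
  have cfP: "cf (P y) m = (if m \<in> {0, - q} then 0 else 1) * cf y m" for y m
    unfolding P_def by (rule cf_multiplier[OF bP])
  have cfE: "cf (E s) m = (if m = 0 then - of_real f1 * s else if m = - q then cnj f0 * s else 0)" for s m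
    using q by (auto simp: E_def)
  have block: "cmod (\<alpha> * cf y 0 + \<beta> * cf y (- q)) \<le> norm y"
    if "cmod \<alpha> \<le> 1" "cmod \<beta> \<le> 1" for \<alpha> \<beta> and y :: "(int ^ 'n) ell1"
  proof -
    have "cmod (\<alpha> * cf y 0 + \<beta> * cf y (- q)) \<le> 1 * cmod (cf y 0) + 1 * cmod (cf y (- q))"
      by (rule order_trans[OF norm_triangle_ineq]) (unfold norm_mult, intro add_mono mult_right_mono that norm_ge_zero)
    then show ?thesis using cf2_le_norm[of 0 "- q" y] q by simp
  qed
  have nf: "norm f \<le> 2"
    unfolding f_def using norm_triangle_ineq[of "single 0 f0" "single (- q) (of_real f1)"] f01
    by (simp add: norm_single)
  \<comment> \<open>Origin of the number 27: for a radius \<open>B = 3\<close> both the bound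
    \<open>B ^ 3\<close> and the Lipschitz constant \<open>3 * B\<^sup>2\<close> of the cubic term
    equal it.\<close>
  have ball: "norm (f + h) \<le> 3" if "norm h \<le> 1" for h
    using norm_triangle_ineq[of f h] nf that by simp
  have "\<exists>y s \<mu>. norm (y + E s) \<le> K \<and> \<bar>\<mu>\<bar> \<le> \<theta>
    \<and> y = R (\<mu> *\<^sub>R (y + E s) - conv x (f + (y + E s)) - \<kappa> *\<^sub>R cubic (f + (y + E s)))
    \<and> \<mu> = Re (\<Phi> (conv x y + \<kappa> *\<^sub>R cubic (f + (y + E s))))
    \<and> of_real (a + c - \<nu> - \<nu>) * s = of_real \<mu> * s - \<Psi> (conv x y + \<kappa> *\<^sub>R cubic (f + (y + E s)))"
    unfolding \<theta>_def K_def
  proof (rule reduced_fixed_point[where P = P])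
    show "linear (conv x)" by (rule bounded_linear.linear[OF conv.bounded_linear_right])
    show "linear R" "linear P" "linear E"
      by (rule linearI; rule ell1_eqI; simp add: cfR cfP cfE algebra_simps scaleR_conv_of_real)+
    show "linear \<Phi>" "linear \<Psi>"
      by (rule linearI; simp add: \<Phi>_def \<Psi>_def algebra_simps scaleR_conv_of_real)+
    show "norm (conv x y) \<le> b * norm y" for y unfolding b_def by (rule norm_conv)
    show "norm (R y) \<le> \<tau> * norm y" for y unfolding R_def by (rule norm_multiplier[OF bR])
    show "norm (P y) \<le> norm y" for y using norm_multiplier[of "\<lambda>m. if m \<in> {0, - q} then 0 else 1" 1 y, OF bP] by (simp add: P_def)
    show "norm (E s) \<le> 2 * cmod s" for s
      unfolding E_def
      using norm_triangle_ineq[of "single 0 (- of_real f1 * s)" "single (- q) (cnj f0 * s)"]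
        mult_right_mono[OF f01(1), of "cmod s"] mult_right_mono[OF f01(2), of "cmod s"]
      by (simp add: norm_single norm_mult)
    show "cmod (\<Phi> y) \<le> norm y" "cmod (\<Psi> y) \<le> norm y" for y
      unfolding \<Phi>_def \<Psi>_def by (rule block; use f01 in simp)+
    show "norm f \<le> 2" by (rule nf)
    show "norm (cubic (f + h)) \<le> 27" if "norm h \<le> 1" for h
      using norm_cubic[OF ball[OF that]] by simp
    show "norm (cubic (f + h) - cubic (f + h')) \<le> 27 * norm (h - h')"
      if "norm h \<le> 1" "norm h' \<le> 1" for h h'
      using norm_cubic_diff[OF ball[OF that(1)] ball[OF that(2)]] by simp
    show "P (R y) = R y" for y by (rule ell1_eqI) (simp add: cfP cfR)
    show "P (E s) = 0" for s by (rule ell1_eqI) (simp add: cfP cfE)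
    show "\<Psi> (R y) = 0" for y by (simp add: \<Psi>_def cfR)
    show "\<Psi> (E s) = s" for s
    proof -
      have "\<Psi> (E s) = (f0 * cnj f0 + of_real f1 * of_real f1) * s"
        using q by (simp add: \<Psi>_def cfE algebra_simps)
      then show ?thesis by (simp add: unit)
    qed
    show "b \<ge> 0" by (simp add: b_def)
  qed (use \<tau> \<kappa> gap K in \<open>simp_all add: K_def \<theta>_def\<close>)
  then obtain y s \<mu> where h: "norm (y + E s) \<le> K" and \<mu>: "\<bar>\<mu>\<bar> \<le> \<theta>"
    and y: "y = R (\<mu> *\<^sub>R (y + E s) - conv x (f + (y + E s)) - \<kappa> *\<^sub>R cubic (f + (y + E s)))"
    and \<mu>\<Phi>: "\<mu> = Re (\<Phi> (conv x y + \<kappa> *\<^sub>R cubic (f + (y + E s))))"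
    and s\<Psi>: "of_real (a + c - \<nu> - \<nu>) * s = of_real \<mu> * s - \<Psi> (conv x y + \<kappa> *\<^sub>R cubic (f + (y + E s)))"
    by blast
  define g where "g = f + (y + E s)"
  define z where "z = conv x y + \<kappa> *\<^sub>R cubic g"
  define \<rho> where "\<rho> = Im (\<Phi> z)"
  define r where "r = (\<nu> + \<mu>) *\<^sub>R g - conv x g - \<kappa> *\<^sub>R cubic g"
  \<comment> \<open>The possible defect of the equation, a purely imaginary multiple of the model
    eigenvector.\<close>
  define d where "d = single 0 (\<i> * of_real \<rho> * f0) + single (- q) (\<i> * of_real \<rho> * of_real f1)"
  have y_block: "cf y 0 = 0" "cf y (- q) = 0" by (subst y, simp add: cfR)+
  have g_block: "cf g 0 = f0 - of_real f1 * s" "cf g (- q) = of_real f1 + cnj f0 * s"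
    using q by (simp_all add: g_def f_def y_block cfE)
  \<comment> \<open>As \<open>y\<close> vanishes on the block, only the columns 0 and
    \<open>- q\<close> of the convolution operator appear explicitly. Inside the block they reduce,
    by \<open>x0\<close>, to the off-diagonal entries of the model matrix.\<close>
  have conv_g: "cf (conv x g) m = cf x m * cf g 0 + cf x (m + q) * cf g (- q) + cf (conv x y) m" for m
  proof -
    have "g = single 0 (cf g 0) + single (- q) (cf g (- q)) + y"
      using q by (intro ell1_eqI) (auto simp: g_block g_def f_def cfE y_block)
    then have "conv x g = conv x (single 0 (cf g 0)) + conv x (single (- q) (cf g (- q))) + conv x y"
      by (metis conv.add_right)
    then show ?thesis by (simp add: cf_conv_single)
  qed
  have \<Phi>z: "\<Phi> z = of_real \<mu> + \<i> * of_real \<rho>"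
    unfolding \<rho>_def \<mu>\<Phi>[folded g_def, folded z_def] by (rule complex_eq)
  have z_block: "cf z 0 = \<Phi> z * f0 - \<Psi> z * of_real f1" "cf z (- q) = \<Phi> z * of_real f1 + \<Psi> z * cnj f0"
  proof -
    have "\<Phi> z * f0 - \<Psi> z * of_real f1 = (f0 * cnj f0 + of_real f1 * of_real f1) * cf z 0"
      "\<Phi> z * of_real f1 + \<Psi> z * cnj f0 = (f0 * cnj f0 + of_real f1 * of_real f1) * cf z (- q)"
      by (simp_all add: \<Phi>_def \<Psi>_def algebra_simps)
    then show "cf z 0 = \<Phi> z * f0 - \<Psi> z * of_real f1" "cf z (- q) = \<Phi> z * of_real f1 + \<Psi> z * cnj f0"
      by (simp_all add: unit)
  qed
  have \<Psi>z: "\<Psi> z = of_real \<mu> * s - of_real (a + c - \<nu> - \<nu>) * s"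
    using s\<Psi>[folded g_def, folded z_def] by simp
  have res: "cf (r + d) m = of_real (\<Lambda> m) * cf g m" for m
  proof -
    consider "m = 0" | "m = - q" | "m \<noteq> 0" "m \<noteq> - q" by blast
    then show ?thesis
    proof cases
      case 1
      have "cf r 0 = of_real (\<nu> + \<mu>) * cf g 0 - w * cf g (- q) - cf z 0"
        by (simp add: r_def conv_g x0 z_def flip: w_def)
      also have "\<dots> = of_real a * cf g 0 - \<i> * of_real \<rho> * f0"
        unfolding g_block z_block \<Phi>z \<Psi>z using f(1) e(1)
        unfolding of_real_add of_real_diff by algebra
      finally show ?thesis using 1 q by (simp add: d_def a_def)
    next
      case 2
      have "cf r (- q) = of_real (\<nu> + \<mu>) * cf g (- q) - cnj w * cf g 0 - cf z (- q)"
        by (simp add: r_def conv_g x0 z_def w')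
      also have "\<dots> = of_real c * cf g (- q) - \<i> * of_real \<rho> * of_real f1"
        unfolding g_block z_block \<Phi>z \<Psi>z using f(2) e(2)
        unfolding of_real_add of_real_diff by algebra
      finally show ?thesis using 2 q by (simp add: d_def c_def)
    next
      case 3
      have "1 \<le> \<tau> * \<bar>\<Lambda> m - \<nu>\<bar>" using 3 by (rule off)
      then have nz: "complex_of_real (\<Lambda> m - \<nu>) \<noteq> 0" by auto
      have gm: "cf g m = cf y m" "cf (y + E s) m = cf y m" using 3 by (simp_all add: g_def f_def cfE)
      have "cf y m = (of_real \<mu> * cf y m - cf (conv x g) m - of_real \<kappa> * cf (cubic g) m) / of_real (\<Lambda> m - \<nu>)"
        using 3 gm(2) by (subst y) (simp add: cfR g_def[symmetric])
      then have "of_real (\<Lambda> m - \<nu>) * cf y m = of_real \<mu> * cf y m - cf (conv x g) m - of_real \<kappa> * cf (cubic g) m"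
        using nz by (metis nonzero_mult_div_cancel_left times_divide_eq_right)
      then show ?thesis using 3 by (simp add: r_def d_def gm algebra_simps)
    qed
  qed
  \<comment> \<open>Only the real part of \<open>\<Phi> z\<close> entered the eigenvalue; pairing the equation with \<open>g\<close> shows that its imaginary part vanishes.\<close>
  have "\<rho> = 0"
  proof -
    \<comment> \<open>By \<open>res\<close> this pairing is the sum of \<open>\<Lambda> m\<close>
      times the squared modulus of \<open>cf g m\<close>, with \<Lambda> real.\<close>
    have "cnj (cf (conv (star g) (r + d)) 0) = cf (conv (star g) (r + d)) 0"
      unfolding cf_conv infsum_cnj[symmetric] by (rule infsum_cong) (simp add: res mult_ac del: cf_add)
    then have "cf (conv (star g) (r + d)) 0 \<in> \<real>" by (simp add: Reals_cnj_iff)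
    \<comment> \<open>This pairing is the mean of a function assembled from the squared modulus of
      \<open>eval g\<close>, the real potential and real constants.\<close>
    moreover have "cf (conv (star g) r) 0 \<in> \<real>"
    proof (rule cf_0_real)
      fix \<theta>
      define p where "p = eval g \<theta> * cnj (eval g \<theta>)"
      have "eval (conv (star g) r) \<theta> = of_real (\<nu> + \<mu>) * p - eval x \<theta> * p - of_real \<kappa> * (p * p)"
        unfolding r_def cubic_def p_def eval_conv eval_diff eval_scaleR eval_star
        by (simp add: algebra_simps)
      moreover have "p \<in> \<real>" by (simp add: p_def flip: complex_norm_square)
      ultimately show "eval (conv (star g) r) \<theta> \<in> \<real>"
        using real by simp
    qed
    moreover have "cf (conv (star g) d) 0 = cnj (cf g 0) * (\<i> * of_real \<rho> * f0) + cnj (cf g (- q)) * (\<i> * of_real \<rho> * of_real f1)"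
      by (simp add: d_def conv.add_right cf_conv_single)
    \<comment> \<open>The terms with \<open>s\<close> cancel by orthogonality of the two
      eigenvectors; what remains is the squared norm of the model eigenvector, which is 1.\<close>
    moreover have "\<dots> = \<i> * of_real \<rho> * (f0 * cnj f0 + of_real f1 * of_real f1)"
      unfolding g_block by (simp add: algebra_simps)
    ultimately have "\<i> * of_real \<rho> \<in> \<real>"
      unfolding conv.add_right cf_add by (simp add: unit) (metis Reals_diff add_diff_cancel_left')
    then show "\<rho> = 0" by (simp add: complex_is_Real_iff)
  qed
  then have "d = 0" by (intro ell1_eqI) (simp add: d_def)
  then show thesis
    using that[OF h \<mu>] res unfolding g_def r_def by simp
qed

section \<open>From coefficient families to classical solutions\<close>

lemma one_plus_power_le: "0 \<le> x \<Longrightarrow> (1 + x) ^ n \<le> 2 ^ n * (1 + x ^ n)" for x :: real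
proof -
  assume x: "0 \<le> x"
  have "(1 + x) ^ n \<le> (2 * max 1 x) ^ n" using x by (intro power_mono) auto
  also have "\<dots> \<le> 2 ^ n * (1 + x ^ n)"
    using x by (auto simp: power_mult_distrib max_def)
  finally show ?thesis .
qed

text \<open>Regularity comes from the equation itself. \<open>L\<close> is again an absolutely
  summable family, and by assumption it is \<open>g\<close> weighted with the power
  \<open>2 * l\<close> of the frequencies; so \<open>g\<close> has \<open>2 * l\<close> summable
  moments and all derivatives may be taken termwise.\<close>

lemma solution_of_coefficients:
  fixes g L x :: "(int ^ 'n::finite) ell1" and V :: "real ^ 'n \<Rightarrow> complex" and A :: complex
    and \<sigma> \<mu> :: real and j :: "int ^ 'n" and t :: "real ^ 'n"
  defines "L \<equiv> \<mu> *\<^sub>R g - conv x g - (\<sigma> * (cmod A)\<^sup>2) *\<^sub>R cubic g"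
    and "u \<equiv> \<lambda>\<theta>. A * cis (Pvec j t \<bullet> \<theta>) * eval g \<theta>"
  assumes L: "\<And>m. cf L m = of_real (pnorm (j + m) t ^ (2 * l)) * cf g m"
    and V: "\<And>\<theta>. eval x \<theta> = V \<theta>"
  shows "solves_equation l V \<sigma> \<mu> u" and "quasi_periodic l t u"
proof -
  define \<omega> where "\<omega> = (\<lambda>m. Pvec (j + m) t)"
  have ex: "expsum \<omega> (\<lambda>m. A * cf y m) \<theta> = A * cis (Pvec j t \<bullet> \<theta>) * eval y \<theta>" for y \<theta>
  proof -
    have "expsum \<omega> (\<lambda>m. A * cf y m) \<theta> = (\<Sum>\<^sub>\<infinity>m. A * cis (Pvec j t \<bullet> \<theta>) * (cf y m * cis (rvec m \<bullet> \<theta>)))"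
      unfolding expsum_def
    proof (rule infsum_cong)
      fix m
      have "cis (\<omega> m \<bullet> \<theta>) = cis (Pvec j t \<bullet> \<theta>) * cis (rvec m \<bullet> \<theta>)"
        by (simp add: \<omega>_def Pvec_def inner_add_left cis_mult add_ac)
      then show "A * cf y m * cis (\<omega> m \<bullet> \<theta>) = A * cis (Pvec j t \<bullet> \<theta>) * (cf y m * cis (rvec m \<bullet> \<theta>))"
        by simp
    qed
    then show ?thesis by (simp add: infsum_cmult_right' eval_def expsum_def)
  qed
  have u: "u = expsum \<omega> (\<lambda>m. A * cf g m)" by (rule ext) (simp only: u_def ex)
  have mom: "moment_summable \<omega> (2 * l) (\<lambda>m. A * cf g m)"
  proof -
    let ?b = "\<lambda>m. 2 ^ (2 * l) * cmod A * (cmod (cf g m) + cmod (cf L m))"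
    have "?b summable_on UNIV"
      by (intro summable_on_cmult_right summable_on_add cf_abs_summable)
    moreover have "cmod (of_real ((1 + norm (\<omega> m)) ^ (2 * l)) * (A * cf g m)) \<le> ?b m" for m
    proof -
      have "cmod (of_real ((1 + norm (\<omega> m)) ^ (2 * l)) * (A * cf g m)) = (1 + norm (\<omega> m)) ^ (2 * l) * cmod (A * cf g m)"
        by (simp only: norm_mult norm_of_real) simp
      also have "\<dots> \<le> 2 ^ (2 * l) * (1 + norm (\<omega> m) ^ (2 * l)) * cmod (A * cf g m)"
        by (intro mult_right_mono one_plus_power_le norm_ge_zero)
      also have "\<dots> = ?b m"
        unfolding L norm_mult norm_of_real by (simp add: \<omega>_def pnorm_def algebra_simps)
      finally show ?thesis .
    qed
    ultimately have "(\<lambda>m. of_real ((1 + norm (\<omega> m)) ^ (2 * l)) * (A * cf g m)) abs_summable_on UNIV"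
      by (rule abs_summable_le)
    moreover have "cmod (of_real ((1 + norm (\<omega> m)) ^ (2 * l)) * (A * cf g m)) = (1 + norm (\<omega> m)) ^ (2 * l) * cmod (A * cf g m)" for m
      by (simp only: norm_mult norm_of_real) simp
    ultimately show ?thesis by (simp only: moment_summable_def)
  qed
  show "quasi_periodic l t u"
    unfolding u \<omega>_def by (rule quasi_periodic_expsum[OF mom[unfolded \<omega>_def]])
  have "(\<lambda>m. of_real (norm (\<omega> m) ^ (2 * l)) * (A * cf g m)) = (\<lambda>m. A * cf L m)"
    unfolding L by (simp add: \<omega>_def pnorm_def mult_ac)
  then have lap: "(neg_laplacian ^^ l) u \<theta> = A * cis (Pvec j t \<bullet> \<theta>) * eval L \<theta>" for \<theta>
    unfolding u neg_laplacian_funpow_expsum[OF mom] by (simp only: ex)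
  have "(neg_laplacian ^^ l) u \<theta> + V \<theta> * u \<theta> + of_real (\<sigma> * (cmod (u \<theta>))\<^sup>2) * u \<theta> = of_real \<mu> * u \<theta>" for \<theta>
  proof -
    define W where "W = eval g \<theta>"
    define X where "X = A * cis (Pvec j t \<bullet> \<theta>)"
    have "eval L \<theta> = of_real \<mu> * W - V \<theta> * W - of_real \<sigma> * of_real ((cmod A)\<^sup>2) * (W * cnj W * W)"
      by (simp add: L_def cubic_def eval_diff eval_scaleR eval_conv eval_star V W_def)
    moreover have "of_real ((cmod (u \<theta>))\<^sup>2) = of_real ((cmod A)\<^sup>2) * (W * cnj W)"
      unfolding complex_norm_square[of W, symmetric] of_real_mult[symmetric]
      by (simp add: u_def W_def norm_mult power_mult_distrib)
    moreover have "u \<theta> = X * W" by (simp add: u_def X_def W_def)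
    ultimately show ?thesis
      unfolding lap X_def[symmetric] of_real_mult by (simp only:) (simp add: algebra_simps)
  qed
  moreover have "C_class (2 * l) u" unfolding u by (rule C_class_expsum[OF mom])
  ultimately show "solves_equation l V \<sigma> \<mu> u" by (simp add: solves_equation_def)
qed

section \<open>Separation of the remaining eigenvalues and the choice of constants\<close>

lemma near_resonant_mono:
  assumes "near_resonant q \<delta> k X r t j" "r \<le> r'"
  shows "near_resonant q \<delta> k X r' t j"
  using assms unfolding near_resonant_def by (meson less_le_trans)

text \<open>Evaluating the separation property at one real point of the circle, its rightmost one,
  makes the modulus a real distance; moving from that point to the centre costs the radius.\<close>

lemma separated_gap:
  fixes m :: "int ^ 'n::finite"
  assumes "separated l v q \<delta> k t j" "\<epsilon> \<in> {1, -1}" "m \<noteq> j" "m \<noteq> j - q"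
  shows "k powr (2 * real l - real CARD('n) - 6 * \<delta>) / 2 - cmod (v q) / 10
    \<le> \<bar>pnorm m t ^ (2 * l) - lam_hat l v q j \<epsilon> t\<bar>"
proof -
  let ?d = "cmod (v q) / 10" and ?\<nu> = "lam_hat l v q j \<epsilon> t"
  have "complex_of_real (?\<nu> + ?d) \<in> sphere (of_real ?\<nu>) ?d"
    by (simp add: dist_norm)
  then have "2 * cmod (of_real (pnorm m t ^ (2 * l)) - complex_of_real (?\<nu> + ?d))
      \<ge> k powr (2 * real l - real CARD('n) - 6 * \<delta>)"
    using assms unfolding separated_def by blast
  moreover have "cmod (of_real (pnorm m t ^ (2 * l)) - complex_of_real (?\<nu> + ?d))
      = \<bar>pnorm m t ^ (2 * l) - (?\<nu> + ?d)\<bar>"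
    unfolding of_real_diff[symmetric] norm_of_real ..
  ultimately show ?thesis using norm_ge_zero[of "v q"] by linarith
qed

theorem theorem24:
  fixes l :: nat and v :: "int ^ 'n::finite \<Rightarrow> complex" and R\<^sub>0 :: real and q :: "int ^ 'n"
  assumes "2 * l > CARD('n)"
    and "\<And>m. v m \<noteq> 0 \<Longrightarrow> 0 < norm (rvec m) \<and> norm (rvec m) \<le> R\<^sub>0"
    and "\<And>x. trig_poly v R\<^sub>0 x \<in> \<real>"
    and "\<exists>x. trig_poly v R\<^sub>0 x \<noteq> 0"
    and "q \<noteq> 0" and "v q \<noteq> 0"
  shows "\<exists>c::real. \<forall>\<gamma>\<^sub>2 \<delta>::real.
    0 < \<gamma>\<^sub>2 \<and> 0 < 9 * \<delta> \<and> 9 * \<delta> < 2 * real l - real CARD('n) \<longrightarrow>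
    (\<exists>k\<^sub>0 > 0. \<exists>C::real. \<forall>X. asymptotically_full q \<delta> X \<longrightarrow>
      (\<forall>k > k\<^sub>0. resonant_set l v q \<delta> k (X k) \<longrightarrow>
        (\<forall>t j. \<forall>\<sigma>::real. \<forall>A::complex.
          near_resonant q \<delta> k (X k) (k powr (- real CARD('n) + 1 - 7 * \<delta>)) t j
          \<and> \<bar>\<sigma>\<bar> * (cmod A)\<^sup>2 < k powr (- \<gamma>\<^sub>2) \<longrightarrow>
          (let \<gamma>\<^sub>1 = (2 * real l - real CARD('n) - 8 * \<delta>) / 2; \<gamma> = min \<gamma>\<^sub>1 \<gamma>\<^sub>2 in
            \<forall>\<epsilon>\<in>{1, -1}. \<exists>u \<mu> \<phi>.
              solves_equation l (trig_poly v R\<^sub>0) \<sigma> \<mu> u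
              \<and> quasi_periodic l t u
              \<and> (\<forall>x. u x = A * cis (Pvec j t \<bullet> x) * (psi l v q j \<epsilon> t x + \<phi> x))
              \<and> periodic \<phi>
              \<and> star_norm \<phi> \<le> ennreal (c * k powr (- \<gamma>))
              \<and> \<bar>\<mu> - lam_hat l v q j \<epsilon> t\<bar> \<le> C * k powr (- \<gamma>)))))"
proof -
  define V where "V = Abs_ell1 v"
  have cfV: "cf V = v" unfolding V_def by (rule cf_potential[OF assms(2)])
  have evV: "eval V \<theta> = trig_poly v R\<^sub>0 \<theta>" for \<theta> unfolding V_def by (rule eval_potential[OF assms(2)])
  have realV: "eval V \<theta> \<in> \<real>" for \<theta> unfolding evV by (rule assms(3))
  have herm: "v (- q) = cnj (v q)" using cf_uminus_of_real_eval[OF realV, of q] by (simp add: cfV)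
  have V0: "cf V 0 = 0" using assms(2)[of 0] by (auto simp: cfV)
  define b where "b = norm V"
  define \<omega>\<^sub>0 where "\<omega>\<^sub>0 = 2 * cmod (v q)"
  \<comment> \<open>\<open>C\<close> and \<open>c\<close> are the bounds \<theta> and
    \<open>K\<close> of the reduction with \<tau> replaced by
    \<open>4 * k powr (- \<gamma>)\<close>, the coupling by \<open>k powr (- \<gamma>)\<close>, and
    the common factor \<open>k powr (- \<gamma>)\<close> taken out. They involve only the norm of
    the potential and \<open>v q\<close>.\<close>
  define C where "C = 4 * (b * (4 * b + 81)) + 27"
  define c where "c = 4 * (4 * b + 81) + 6 * C / \<omega>\<^sub>0"
  have b: "b \<ge> 0" by (simp add: b_def)
  have \<omega>0: "\<omega>\<^sub>0 > 0" using assms(6) by (simp add: \<omega>\<^sub>0_def)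
  show ?thesis
  proof (rule exI[of _ c], intro allI impI, elim conjE)
    fix \<gamma>\<^sub>2 \<delta> :: real
    assume \<gamma>2: "0 < \<gamma>\<^sub>2" and \<delta>: "0 < 9 * \<delta>" "9 * \<delta> < 2 * real l - real CARD('n)"
    define p where "p = 2 * real l - real CARD('n) - 6 * \<delta>"
    define \<gamma> where "\<gamma> = min ((2 * real l - real CARD('n) - 8 * \<delta>) / 2) \<gamma>\<^sub>2"
    \<comment> \<open>The inequality \<open>\<gamma> \<le> p\<close> amounts, for the first entry of
      the minimum, to \<open>4 * \<delta> \<le> 2 * real l - real CARD('n)\<close>.\<close>
    have p: "p > 0" and \<gamma>: "\<gamma> > 0" "\<gamma> \<le> p" "\<gamma> \<le> \<gamma>\<^sub>2"
      using \<gamma>2 \<delta> by (auto simp: p_def \<gamma>_def min_def)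
    have powr_small: "\<forall>\<^sub>F k in at_top. a * k powr (- e) < 1 / 2" if "e > 0" for a e :: real
    proof -
      have "((\<lambda>k. a * k powr (- e)) \<longlongrightarrow> a * 0) at_top"
        using that by (intro tendsto_mult_left tendsto_neg_powr filterlim_ident) simp
      then show ?thesis by (rule order_tendstoD(2)) simp
    qed
    \<comment> \<open>The first condition makes the reduction a contraction. The second lets half of
      the separation absorb the radius of the circle.\<close>
    obtain k\<^sub>1 where k1: "\<And>k. k \<ge> k\<^sub>1 \<Longrightarrow> c * k powr (- \<gamma>) < 1 / 2 \<and> cmod (v q) * k powr (- p) < 1 / 2"
      using eventually_conj[OF powr_small[OF \<gamma>(1), of c] powr_small[OF p, of "cmod (v q)"]]
      unfolding eventually_at_top_linorder by blast
    show "\<exists>k\<^sub>0>0. \<exists>C. \<forall>X. asymptotically_full q \<delta> X \<longrightarrow>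
      (\<forall>k > k\<^sub>0. resonant_set l v q \<delta> k (X k) \<longrightarrow>
        (\<forall>t j \<sigma> A.
          near_resonant q \<delta> k (X k) (k powr (- real CARD('n) + 1 - 7 * \<delta>)) t j
          \<and> \<bar>\<sigma>\<bar> * (cmod A)\<^sup>2 < k powr (- \<gamma>\<^sub>2) \<longrightarrow>
          (let \<gamma>\<^sub>1 = (2 * real l - real CARD('n) - 8 * \<delta>) / 2; \<gamma> = min \<gamma>\<^sub>1 \<gamma>\<^sub>2 in
            \<forall>\<epsilon>\<in>{1, -1}. \<exists>u \<mu> \<phi>.
              solves_equation l (trig_poly v R\<^sub>0) \<sigma> \<mu> u
              \<and> quasi_periodic l t u
              \<and> (\<forall>x. u x = A * cis (Pvec j t \<bullet> x) * (psi l v q j \<epsilon> t x + \<phi> x))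
              \<and> periodic \<phi>
              \<and> star_norm \<phi> \<le> ennreal (c * k powr (- \<gamma>))
              \<and> \<bar>\<mu> - lam_hat l v q j \<epsilon> t\<bar> \<le> C * k powr (- \<gamma>))))"
      unfolding Let_def \<gamma>_def[symmetric]
    proof (rule exI[of _ "max 1 k\<^sub>1"], intro exI[of _ C] conjI allI impI ballI, simp, elim conjE)
      fix X :: "real \<Rightarrow> (real ^ 'n) set" and k t j and \<sigma> :: real and A :: complex and \<epsilon> :: real
      assume k: "max 1 k\<^sub>1 < k" and res: "resonant_set l v q \<delta> k (X k)"
        and near: "near_resonant q \<delta> k (X k) (k powr (- real CARD('n) + 1 - 7 * \<delta>)) t j"
        and small: "\<bar>\<sigma>\<bar> * (cmod A)\<^sup>2 < k powr (- \<gamma>\<^sub>2)" and \<epsilon>: "\<epsilon> \<in> {1, -1}"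
      have k: "k > 1" "c * k powr (- \<gamma>) < 1 / 2" "cmod (v q) \<le> k powr p"
        using k k1[of k] norm_ge_zero[of "v q"]
        by (auto simp: powr_minus field_simps simp del: norm_ge_zero)
      have sep: "separated l v q \<delta> k t j"
        using res near_resonant_mono[OF near, of "2 * k powr (- real CARD('n) + 1 - 7 * \<delta>)"]
        unfolding resonant_set_def by simp
      define \<Lambda> where "\<Lambda> m = pnorm (j + m) t ^ (2 * l)" for m
      define \<nu> where "\<nu> = lam_hat l v q j \<epsilon> t"
      \<comment> \<open>The reciprocal of \<open>k powr p / 4\<close>, the lower bound for the
        distance of \<nu> from the diagonal entries off the block.\<close>
      define \<tau> where "\<tau> = 4 * k powr (- p)"
      have \<Lambda>0: "pnorm j t ^ (2 * l) = \<Lambda> 0" "pnorm (j - q) t ^ (2 * l) = \<Lambda> (- q)"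
        by (simp_all add: \<Lambda>_def)
      obtain f0 f1 s where unit: "f0 * cnj f0 + of_real f1 * of_real f1 = 1" and s: "cmod s \<le> 1"
        and E: "E_hat l v q j \<epsilon> t j j = s * f0" "E_hat l v q j \<epsilon> t (j - q) j = s * of_real f1"
        and f: "of_real (\<Lambda> 0) * f0 + v q * of_real f1 = of_real \<nu> * f0"
          "cnj (v q) * f0 + of_real (\<Lambda> (- q)) * of_real f1 = of_real \<nu> * of_real f1"
          "of_real (\<Lambda> 0) * - of_real f1 + v q * cnj f0 = of_real (\<Lambda> 0 + \<Lambda> (- q) - \<nu>) * - of_real f1"
          "cnj (v q) * - of_real f1 + of_real (\<Lambda> (- q)) * cnj f0 = of_real (\<Lambda> 0 + \<Lambda> (- q) - \<nu>) * cnj f0"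
        and gap: "\<bar>\<Lambda> 0 + \<Lambda> (- q) - \<nu> - \<nu>\<bar> \<ge> \<omega>\<^sub>0"
        by (rule E_hat_column[where j = j and t = t and l = l, OF herm assms(6,5) \<epsilon>,
              unfolded \<Lambda>0, folded \<nu>_def \<omega>\<^sub>0_def])
      define \<kappa> where "\<kappa> = \<sigma> * (cmod (A * s))\<^sup>2"
      have off: "1 \<le> \<tau> * \<bar>\<Lambda> m - \<nu>\<bar>" if "m \<noteq> 0" "m \<noteq> - q" for m
      proof -
        have "j + m \<noteq> j" "j + m \<noteq> j - q" using that by (auto simp: diff_conv_add_uminus simp del: add_uminus_conv_diff)
        from separated_gap[OF sep \<epsilon> this] have "k powr p / 2 - cmod (v q) / 10 \<le> \<bar>\<Lambda> m - \<nu>\<bar>"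
          by (simp only: p_def \<Lambda>_def \<nu>_def)
        then have "k powr p / 4 \<le> \<bar>\<Lambda> m - \<nu>\<bar>" using k(3) norm_ge_zero[of "v q"] by linarith
        then have "\<tau> * (k powr p / 4) \<le> \<tau> * \<bar>\<Lambda> m - \<nu>\<bar>"
          by (rule mult_left_mono) (simp add: \<tau>_def)
        moreover have "\<tau> * (k powr p / 4) = 1"
          using k(1) by (simp add: \<tau>_def powr_minus)
        ultimately show ?thesis by simp
      qed
      have le: "k powr (- p) \<le> k powr (- \<gamma>)" "k powr (- \<gamma>\<^sub>2) \<le> k powr (- \<gamma>)" "k powr (- \<gamma>) \<le> 1"
        using k(1) \<gamma> powr_mono[of "- \<gamma>" 0 k] by (simp_all add: powr_mono)
      have "(cmod (A * s))\<^sup>2 \<le> (cmod A)\<^sup>2"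
        using s by (intro power_mono) (simp_all add: norm_mult mult_left_le)
      then have "\<bar>\<kappa>\<bar> \<le> \<bar>\<sigma>\<bar> * (cmod A)\<^sup>2"
        by (simp add: \<kappa>_def abs_mult mult_left_mono)
      then have \<kappa>: "\<bar>\<kappa>\<bar> \<le> k powr (- \<gamma>)" using small le(2) by linarith
      define \<theta> where "\<theta> = b * (4 * b + 81) * \<tau> + 27 * \<bar>\<kappa>\<bar>"
      define K where "K = (4 * b + 81) * \<tau> + 6 * \<theta> / \<omega>\<^sub>0"
      have \<theta>: "\<theta> \<le> C * k powr (- \<gamma>)"
      proof -
        have "b * (4 * b + 81) * \<tau> \<le> b * (4 * b + 81) * (4 * k powr (- \<gamma>))"
          unfolding \<tau>_def using b le by (intro mult_left_mono) auto
        then show ?thesis using \<kappa> by (simp add: \<theta>_def C_def algebra_simps)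
      qed
      have K: "K \<le> c * k powr (- \<gamma>)"
      proof -
        have "(4 * b + 81) * \<tau> \<le> (4 * b + 81) * (4 * k powr (- \<gamma>))"
          unfolding \<tau>_def using b le by (intro mult_left_mono) auto
        moreover have "6 * \<theta> / \<omega>\<^sub>0 \<le> 6 * (C * k powr (- \<gamma>)) / \<omega>\<^sub>0"
          using \<theta> \<omega>0 by (intro divide_right_mono) auto
        ultimately show ?thesis by (simp add: K_def c_def algebra_simps)
      qed
      define f where "f = single 0 f0 + single (- q) (of_real f1)"
      obtain h \<mu> where h: "norm h \<le> K" and \<mu>: "\<bar>\<mu>\<bar> \<le> \<theta>"
        and eig: "\<And>m. cf ((\<nu> + \<mu>) *\<^sub>R (f + h) - conv V (f + h) - \<kappa> *\<^sub>R cubic (f + h)) m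
          = of_real (\<Lambda> m) * cf (f + h) m"
      proof (rule nonlinear_eigenvector_exists[where q = q and x = V and \<Lambda> = \<Lambda> and ?f0.0 = f0 and ?f1.0 = f1
            and \<nu> = \<nu> and \<omega>\<^sub>0 = \<omega>\<^sub>0 and \<tau> = \<tau> and \<kappa> = \<kappa>,
            folded f_def b_def, folded \<theta>_def, folded K_def])
        show "\<bar>\<kappa>\<bar> \<le> 1" using \<kappa> le(3) by linarith
        show "K \<le> 1 / 2" using K k(2) by linarith
      qed (use assms(5) realV V0 unit f gap \<omega>0 off in \<open>simp_all add: cfV \<tau>_def\<close>)
      define u where "u x = (A * s) * cis (Pvec j t \<bullet> x) * eval (f + h) x" for x
      \<comment> \<open>By \<open>E\<close> the function \<open>psi\<close> is \<open>s\<close>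
        times the evaluated unit eigenvector \<open>f\<close>, so the correction has to be scaled by
        \<open>s\<close> as well; its norm does not grow because \<open>s\<close> has modulus at
        most 1.\<close>
      define \<phi> where "\<phi> x = s * eval h x" for x
      have \<phi>: "\<phi> = eval (multiplier (\<lambda>_. s) h)"
      proof
        have "cf (multiplier (\<lambda>_. s) h) = (\<lambda>m. s * cf h m)"
          by (rule ext, rule cf_multiplier[of _ "cmod s"]) simp
        then show "\<phi> x = eval (multiplier (\<lambda>_. s) h) x" for x
          by (simp add: \<phi>_def eval_def expsum_def mult.assoc infsum_cmult_right')
      qed
      have "norm (multiplier (\<lambda>_. s) h) \<le> 1 * norm h"
        by (rule norm_multiplier) (rule s)
      then have "star_norm \<phi> \<le> ennreal (c * k powr (- \<gamma>))"
        unfolding \<phi> star_norm_eval using h K by (intro ennreal_leI) linarith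
      moreover have "periodic \<phi>" unfolding \<phi> by (rule periodic_eval)
      moreover have "u x = A * cis (Pvec j t \<bullet> x) * (psi l v q j \<epsilon> t x + \<phi> x)" for x
        by (simp add: u_def psi_def E \<phi>_def f_def eval_add eval_single algebra_simps)
      moreover have "solves_equation l (trig_poly v R\<^sub>0) \<sigma> (\<nu> + \<mu>) u" "quasi_periodic l t u"
        unfolding u_def using eig evV
        by (auto intro!: solution_of_coefficients[of "\<nu> + \<mu>" "f + h" V \<sigma> "A * s" j t l] simp: \<kappa>_def \<Lambda>_def)
      moreover have "\<bar>\<nu> + \<mu> - lam_hat l v q j \<epsilon> t\<bar> \<le> C * k powr (- \<gamma>)"
        using \<mu> \<theta> by (simp add: \<nu>_def)
      ultimately show "\<exists>u \<mu> \<phi>.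
              solves_equation l (trig_poly v R\<^sub>0) \<sigma> \<mu> u
              \<and> quasi_periodic l t u
              \<and> (\<forall>x. u x = A * cis (Pvec j t \<bullet> x) * (psi l v q j \<epsilon> t x + \<phi> x))
              \<and> periodic \<phi>
              \<and> star_norm \<phi> \<le> ennreal (c * k powr (- \<gamma>))
              \<and> \<bar>\<mu> - lam_hat l v q j \<epsilon> t\<bar> \<le> C * k powr (- \<gamma>)"
        by blast
    qed
  qed
qed

end
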